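(* Let $T>0$, $\mathbb{T}=[0,T]$, $H\in(0,1)$ with $H\ne 1/2$, and let $\{q(i,\cdot)\}_{i=0}^\infty$ be an orthonormal basis of the real space $L_2(\mathbb{T})$ such that every $q(j,\cdot)$ belongs to the domain of the rightmost multiplication operator below, i.e. $t^{-|H-1/2|}q(j,t)\in L_2(\mathbb{T})$ for all $j$ (for instance, the orthonormal Legendre polynomials on $[0,T]$). Then the spectral characteristic $K^H$ of the operator $\mathcal{K}_H$ defining the fractional Brownian motion satisfies $$K^H=\begin{cases} a_H\,P^{-2H}A^{1/2-H}P^{-(1/2-H)}A^{H-1/2} & \text{for } H<1/2,\\[2pt] a_H\,P^{-1}A^{H-1/2}P^{-(H-1/2)}A^{1/2-H} & \text{for } H>1/2,\end{cases}$$ where $A^\alpha$ is the spectral characteristic of the operator of multiplication by $t^\alpha$ and $P^{-\beta}$ is the spectral characteristic of the left-sided Riemann--Liouville integration operator $\mathcal{J}_{0+}^\beta$.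
   Context: The spectral characteristic of a linear operator $\mathcal{L}$ (with domain in $L_2(\mathbb{T})$ containing the basis and values in $L_2(\mathbb{T})$) relative to $\{q(i,\cdot)\}_{i=0}^\infty$ is the infinite matrix with elements $(q(i,\cdot),\mathcal{L}q(j,\cdot))_{L_2(\mathbb{T})}$, $i,j=0,1,2,\dots$. Products of infinite matrices are defined entrywise by $(LM)_{ij}=\sum_{k=0}^\infty L_{ik}M_{kj}$. Operators: for $\alpha>-1/2$, $\mathcal{A}_{f_\alpha}\varphi(t)=t^\alpha\varphi(t)$, with spectral characteristic $A^\alpha$; for $\beta>0$, $\mathcal{J}_{0+}^\beta\varphi(t)=\frac{1}{\Gamma(\beta)}\int_0^t(t-\tau)^{\beta-1}\varphi(\tau)\,d\tau$, with spectral characteristic $P^{-\beta}$; $\mathcal{K}_H\varphi(t)=\int_0^tk_H(t,\tau)\varphi(\tau)\,d\tau$, with spectral characteristic $K^H$, where $$k_H(t,\tau)=\frac{a_H}{\Gamma(H+1/2)}\,(t-\tau)^{H-1/2}\;{}_2F_1\!\left(\tfrac12-H,\;H-\tfrac12;\;H+\tfrac12;\;1-\tfrac{t}{\tau}\right)\ \text{ for } t>\tau>0,\qquad k_H(t,\tau)=0\ \text{ for } t\le\tau,$$ $$a_H=\sqrt{\frac{2H\,\Gamma(H+1/2)\,\Gamma(3/2-H)}{\Gamma(2-2H)}},$$ and ${}_2F_1$ is the Gauss hypergeometric function (analytically continued to $(-\infty,0)$). With this kernel, $B_H(t)=\int_0^tk_H(t,\tau)\,dB(\tau)$ is the fractional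 Brownian motion with Hurst index $H$ when $B$ is a standard Brownian motion. It is known (Decreusefond and Üstünel) that $\mathcal{K}_H=a_H\,\mathcal{J}_{0+}^{2H}\circ\mathcal{A}_{f_{1/2-H}}\circ\mathcal{J}_{0+}^{1/2-H}\circ\mathcal{A}_{f_{H-1/2}}$ for $H<1/2$ and $\mathcal{K}_H=a_H\,\mathcal{J}_{0+}^{1}\circ\mathcal{A}_{f_{H-1/2}}\circ\mathcal{J}_{0+}^{H-1/2}\circ\mathcal{A}_{f_{1/2-H}}$ for $H>1/2$. *)

theory Defs
  imports "HOL-Complex_Analysis.Complex_Analysis"
begin

section \<open>The real space of square-integrable functions on an interval\<close>

text \<open>Elements of the Hilbert space are handled through Borel representatives; equality in the
  space is equality almost everywhere.\<close>

definition L2_space :: "real \<Rightarrow> (real \<Rightarrow> real) set" where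
  "L2_space T = {f. set_borel_measurable lborel {0..T} f \<and>
                    set_integrable lborel {0..T} (\<lambda>t. (f t)\<^sup>2)}"

definition L2_inner :: "real \<Rightarrow> (real \<Rightarrow> real) \<Rightarrow> (real \<Rightarrow> real) \<Rightarrow> real" where
  "L2_inner T f g = (LBINT t:{0..T}. f t * g t)"

definition L2_orthonormal_basis :: "real \<Rightarrow> (nat \<Rightarrow> real \<Rightarrow> real) \<Rightarrow> bool" where
  "L2_orthonormal_basis T q \<longleftrightarrow>
     (\<forall>i. q i \<in> L2_space T) \<and>
     (\<forall>i j. L2_inner T (q i) (q j) = (if i = j then 1 else 0)) \<and>
     (\<forall>f\<in>L2_space T.
        (\<lambda>n. LBINT t:{0..T}. (f t - (\<Sum>i<n. L2_inner T (q i) f * q i t))\<^sup>2) \<longlonglongrightarrow> 0)"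

section \<open>Infinite matrices\<close>

type_synonym inf_matrix = "nat \<Rightarrow> nat \<Rightarrow> real"

definition inf_mult :: "inf_matrix \<Rightarrow> inf_matrix \<Rightarrow> inf_matrix" (infixl "\<star>" 70) where
  "L \<star> M = (\<lambda>i j. \<Sum>k. L i k * M k j)"

definition inf_mult_converges :: "inf_matrix \<Rightarrow> inf_matrix \<Rightarrow> bool" where
  "inf_mult_converges L M \<longleftrightarrow> (\<forall>i j. summable (\<lambda>k. L i k * M k j))"

definition inf_scale :: "real \<Rightarrow> inf_matrix \<Rightarrow> inf_matrix" (infixr "\<odot>" 69) where
  "c \<odot> M = (\<lambda>i j. c * M i j)"

text \<open>Multiplication of infinite matrices is neither total nor associative in general.
  The predicate below says that, for every way of bracketing the product of the listed factors,
  all series that occur converge, and that the value is always the same matrix.\<close>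

inductive bracketing_invariant :: "inf_matrix list \<Rightarrow> inf_matrix \<Rightarrow> bool" where
  single: "bracketing_invariant [M] M"
| split: "2 \<le> length Ms \<Longrightarrow>
    (\<forall>n. 0 < n \<and> n < length Ms \<longrightarrow>
       (\<exists>L R. bracketing_invariant (take n Ms) L \<and> bracketing_invariant (drop n Ms) R \<and>
              inf_mult_converges L R \<and> L \<star> R = N)) \<Longrightarrow>
    bracketing_invariant Ms N"

definition well_defined_product :: "inf_matrix list \<Rightarrow> bool" where
  "well_defined_product Ms \<longleftrightarrow> (\<exists>N. bracketing_invariant Ms N)"

section \<open>Spectral characteristics\<close>

definition has_spectral_characteristic ::
    "real \<Rightarrow> (nat \<Rightarrow> real \<Rightarrow> real) \<Rightarrow> ((real \<Rightarrow> real) \<Rightarrow> (real \<Rightarrow> real)) \<Rightarrow> bool" where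
  "has_spectral_characteristic T q \<L> \<longleftrightarrow> (\<forall>j. q j \<in> L2_space T \<and> \<L> (q j) \<in> L2_space T)"

definition spectral_characteristic ::
    "real \<Rightarrow> (nat \<Rightarrow> real \<Rightarrow> real) \<Rightarrow> ((real \<Rightarrow> real) \<Rightarrow> (real \<Rightarrow> real)) \<Rightarrow> inf_matrix" where
  "spectral_characteristic T q \<L> = (\<lambda>i j. L2_inner T (q i) (\<L> (q j)))"

definition power_mult_op :: "real \<Rightarrow> (real \<Rightarrow> real) \<Rightarrow> (real \<Rightarrow> real)" where
  "power_mult_op \<alpha> \<phi> = (\<lambda>t. t powr \<alpha> * \<phi> t)"

definition riemann_liouville :: "real \<Rightarrow> (real \<Rightarrow> real) \<Rightarrow> (real \<Rightarrow> real)" where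
  "riemann_liouville \<beta> \<phi> =
     (\<lambda>t. 1 / Gamma \<beta> * (LBINT \<tau>:{0..t}. (t - \<tau>) powr (\<beta> - 1) * \<phi> \<tau>))"

section \<open>The kernel of fractional Brownian motion\<close>

text \<open>The Gauss hypergeometric function: the analytic continuation of the hypergeometric series
  from the unit disc to the plane cut along the real half-line from 1 to infinity.
  As the cut plane is connected, the choice is unique there.\<close>

definition gauss_2F1 :: "complex \<Rightarrow> complex \<Rightarrow> complex \<Rightarrow> complex \<Rightarrow> complex" where
  "gauss_2F1 a b c =
     (SOME F. F holomorphic_on (- complex_of_real ` {1..}) \<and>
              (\<forall>z\<in>ball 0 1. F z = eval_fps (fps_hypergeo [a, b] [c] 1) z))"

definition fbm_const :: "real \<Rightarrow> real" where
  "fbm_const H = sqrt (2 * H * Gamma (H + 1/2) * Gamma (3/2 - H) / Gamma (2 - 2 * H))"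

text \<open>With real parameters the hypergeometric function is real on the negative half-axis, so that
  taking the real part only changes the type.\<close>

definition fbm_kernel :: "real \<Rightarrow> real \<Rightarrow> real \<Rightarrow> real" where
  "fbm_kernel H t \<tau> =
     (if 0 < \<tau> \<and> \<tau> < t
      then fbm_const H / Gamma (H + 1/2) * (t - \<tau>) powr (H - 1/2) *
           Re (gauss_2F1 (complex_of_real (1/2 - H)) (complex_of_real (H - 1/2))
                 (complex_of_real (H + 1/2)) (complex_of_real (1 - t / \<tau>)))
      else 0)"

definition fbm_op :: "real \<Rightarrow> (real \<Rightarrow> real) \<Rightarrow> (real \<Rightarrow> real)" where
  "fbm_op H \<phi> = (\<lambda>t. LBINT \<tau>:{0..t}. fbm_kernel H t \<tau> * \<phi> \<tau>)"

abbreviation spectral_A :: "real \<Rightarrow> (nat \<Rightarrow> real \<Rightarrow> real) \<Rightarrow> real \<Rightarrow> inf_matrix" where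
  "spectral_A T q \<alpha> \<equiv> spectral_characteristic T q (power_mult_op \<alpha>)"

text \<open>The index is the order of integration: this is the matrix written with the exponent
  minus \<open>\<beta>\<close> in the usual notation.\<close>

abbreviation spectral_P :: "real \<Rightarrow> (nat \<Rightarrow> real \<Rightarrow> real) \<Rightarrow> real \<Rightarrow> inf_matrix" where
  "spectral_P T q \<beta> \<equiv> spectral_characteristic T q (riemann_liouville \<beta>)"

abbreviation spectral_K :: "real \<Rightarrow> (nat \<Rightarrow> real \<Rightarrow> real) \<Rightarrow> real \<Rightarrow> inf_matrix" where
  "spectral_K T q H \<equiv> spectral_characteristic T q (fbm_op H)"

end

theory Submission
  imports Defs
begin

text \<open>With \<open>b = \<bar>H - 1/2\<bar>\<close>, and \<open>d = 2 * H\<close> for \<open>H < 1/2\<close>, \<open>d = 1\<close> for \<open>H > 1/2\<close>, one has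
  \<open>b + d = H + 1/2\<close>, and both cases of the theorem are the factorisation
  \<open>a\<^sub>H J\<^sup>d t\<^sup>b J\<^sup>b t\<^sup>-\<^sup>b\<close> of the fractional Brownian motion operator.
  Composing the two Riemann--Liouville kernels (Fubini) and substituting \<open>s = r + (t - r) x\<close> turns the
  product kernel into Euler's integral for the hypergeometric function at \<open>1 - t / r\<close>.
  By Parseval's identity, a product of spectral characteristics is the spectral characteristic of
  the composition as soon as the left factor maps the space into itself and has an adjoint there.
  Only the rightmost factor \<open>t\<^sup>-\<^sup>b\<close> fails to have this property, so every bracketing of the product is
  harmless. The Riemann--Liouville operators have it by Schur's test.\<close>

section \<open>Integral operators on square-integrable functions\<close>

text \<open>Two obstacles shape the proof. \<open>gauss_2F1\<close> is picked by
  \<open>SOME\<close>, so nothing is known about it until one analytic continuation of the series is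
  exhibited; Euler's integral is that witness, and the identity theorem on the connected cut plane
  then pins down the choice. One formula serves both ranges of H because the first two parameters,
  1/2 - H and H - 1/2, are - b and b in some order and the function is symmetric in them; Euler's
  integral asks for b > 0 and d = H + 1/2 - b > 0. The other obstacle is t powr (- b), unbounded
  near 0: it is known to keep the basis functions square integrable, so it may stand only at the
  right end, where it meets them directly. What it produces is just an element of the space, for
  which Schur's bound gives the absolute convergence behind Fubini's theorem at almost every t. The
  factorisation is therefore an equality almost everywhere, which inner products cannot distinguish
  from equality.\<close>

definition square_integrable :: "'a measure \<Rightarrow> ('a \<Rightarrow> real) set" where
  "square_integrable M = {f \<in> borel_measurable M. integrable M (\<lambda>x. (f x)\<^sup>2)}"

definition kernel_op :: "'a measure \<Rightarrow> ('a \<Rightarrow> 'a \<Rightarrow> real) \<Rightarrow> ('a \<Rightarrow> real) \<Rightarrow> 'a \<Rightarrow> real" where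
  "kernel_op M k f = (\<lambda>t. LINT s|M. k t s * f s)"

text \<open>The bounds are extended integrals of a nonnegative kernel, so they presuppose no
  integrability. One constant serves rows and columns, which makes the notion stable under
  transposition and hence suited to adjoints.\<close>

definition schur_kernel :: "'a measure \<Rightarrow> ('a \<Rightarrow> 'a \<Rightarrow> real) \<Rightarrow> real \<Rightarrow> bool" where
  "schur_kernel M k C \<longleftrightarrow> case_prod k \<in> borel_measurable (M \<Otimes>\<^sub>M M) \<and> (\<forall>t s. 0 \<le> k t s) \<and> 0 \<le> C \<and>
     (\<forall>t\<in>space M. (\<integral>\<^sup>+ s. ennreal (k t s) \<partial>M) \<le> ennreal C) \<and>
     (\<forall>s\<in>space M. (\<integral>\<^sup>+ t. ennreal (k t s) \<partial>M) \<le> ennreal C)"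

section \<open>Algebra of square-integrable functions\<close>

lemma square_integrable_iff_nn_integral:
  "f \<in> square_integrable M \<longleftrightarrow>
     f \<in> borel_measurable M \<and> (\<integral>\<^sup>+x. (ennreal \<bar>f x\<bar>)\<^sup>2 \<partial>M) < \<infinity>"
  by (auto simp: square_integrable_def integrable_iff_bounded ennreal_power)

lemma integrable_mult_square_integrable:
  assumes "f \<in> square_integrable M" "g \<in> square_integrable M"
  shows "integrable M (\<lambda>x. f x * g x)"
proof (rule Bochner_Integration.integrable_bound[where f = "\<lambda>x. (f x)\<^sup>2 + (g x)\<^sup>2"])
  show "AE x in M. norm (f x * g x) \<le> norm ((f x)\<^sup>2 + (g x)\<^sup>2)"
  proof (rule AE_I2)
    fix x
    have "2 * (\<bar>f x\<bar> * \<bar>g x\<bar>) \<le> (f x)\<^sup>2 + (g x)\<^sup>2"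
      using sum_squares_bound[of "\<bar>f x\<bar>" "\<bar>g x\<bar>"] by simp
    then show "norm (f x * g x) \<le> norm ((f x)\<^sup>2 + (g x)\<^sup>2)"
      by (simp add: abs_mult) (smt (verit) mult_nonneg_nonneg abs_ge_zero)
  qed
qed (use assms in \<open>auto simp: square_integrable_def\<close>)

lemma square_integrable_add:
  assumes "f \<in> square_integrable M" "g \<in> square_integrable M"
  shows "(\<lambda>x. f x + g x) \<in> square_integrable M"
proof -
  have "integrable M (\<lambda>x. (f x)\<^sup>2 + (g x)\<^sup>2 + 2 * (f x * g x))"
    using assms integrable_mult_square_integrable[OF assms] by (auto simp: square_integrable_def)
  then show ?thesis
    using assms by (auto simp: square_integrable_def power2_sum algebra_simps)
qed

lemma square_integrable_bounded_mult:
  assumes "f \<in> square_integrable M" and [measurable]: "h \<in> borel_measurable M"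
    and bound: "\<And>x. x \<in> space M \<Longrightarrow> \<bar>h x\<bar> \<le> B"
  shows "(\<lambda>x. h x * f x) \<in> square_integrable M"
proof -
  have [measurable]: "f \<in> borel_measurable M" and int: "integrable M (\<lambda>x. (f x)\<^sup>2)"
    using assms(1) by (auto simp: square_integrable_def)
  have "integrable M (\<lambda>x. (h x * f x)\<^sup>2)"
  proof (rule Bochner_Integration.integrable_bound[where f = "\<lambda>x. B\<^sup>2 * (f x)\<^sup>2"])
    show "AE x in M. norm ((h x * f x)\<^sup>2) \<le> norm (B\<^sup>2 * (f x)\<^sup>2)"
    proof (rule AE_I2)
      fix x assume "x \<in> space M"
      then have "\<bar>h x\<bar> \<le> \<bar>B\<bar>"
        using bound[of x] by simp
      then have "(h x)\<^sup>2 \<le> B\<^sup>2"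
        by (simp add: abs_le_square_iff)
      then show "norm ((h x * f x)\<^sup>2) \<le> norm (B\<^sup>2 * (f x)\<^sup>2)"
        by (simp add: power_mult_distrib mult_right_mono)
    qed
  qed (use int in auto)
  then show ?thesis by (simp add: square_integrable_def)
qed

lemma square_integrable_scale:
  "f \<in> square_integrable M \<Longrightarrow> (\<lambda>x. c * f x) \<in> square_integrable M"
  using square_integrable_bounded_mult[of f M "\<lambda>_. c" "\<bar>c\<bar>"] by simp

lemma square_integrable_sum:
  assumes "\<And>i. i \<in> I \<Longrightarrow> f i \<in> square_integrable M"
  shows "(\<lambda>x. \<Sum>i\<in>I. f i x) \<in> square_integrable M"
  using assms
proof (induction I rule: infinite_finite_induct)
  case (insert i I)
  then show ?case using square_integrable_add[of "f i" M "\<lambda>x. \<Sum>i\<in>I. f i x"] by simp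
qed (simp_all add: square_integrable_def)

lemma square_integrable_cong_AE:
  assumes "f \<in> square_integrable M" "g \<in> borel_measurable M" "AE x in M. f x = g x"
  shows "g \<in> square_integrable M"
proof -
  have "integrable M (\<lambda>x. (g x)\<^sup>2) \<longleftrightarrow> integrable M (\<lambda>x. (f x)\<^sup>2)"
    by (rule integrable_cong_AE) (use assms in \<open>auto simp: square_integrable_def\<close>)
  then show ?thesis using assms by (auto simp: square_integrable_def)
qed

text \<open>Schur's test: with k split as sqrt k times sqrt k, Cauchy-Schwarz in s leaves a row
  integral, bounded by C; after exchanging the integrals a column integral gives the second C. An
  extended-valued g is allowed because the estimate is later applied to inner integrals that may be
  infinite on a null set.\<close>

lemma (in sigma_finite_measure) schur_nn_integral_bound:
  fixes g :: "'a \<Rightarrow> ennreal"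
  assumes k: "schur_kernel M k C" and [measurable]: "g \<in> borel_measurable M"
  shows "(\<integral>\<^sup>+t. (\<integral>\<^sup>+s. ennreal (k t s) * g s \<partial>M)\<^sup>2 \<partial>M) \<le> (ennreal C)\<^sup>2 * (\<integral>\<^sup>+s. (g s)\<^sup>2 \<partial>M)"
proof -
  have [measurable]: "case_prod k \<in> borel_measurable (M \<Otimes>\<^sub>M M)" and k0: "\<And>t s. 0 \<le> k t s"
    using k by (auto simp: schur_kernel_def)
  have sqrt_sq: "(ennreal (sqrt (k t s)))\<^sup>2 = ennreal (k t s)" for t s
    by (simp add: ennreal_power k0)
  have "(\<integral>\<^sup>+s. ennreal (k t s) * g s \<partial>M)\<^sup>2 \<le> ennreal C * (\<integral>\<^sup>+s. ennreal (k t s) * (g s)\<^sup>2 \<partial>M)"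
    if t: "t \<in> space M" for t
  proof -
    have [measurable]: "k t \<in> borel_measurable M" using t by measurable
    have "(\<integral>\<^sup>+s. ennreal (k t s) * g s \<partial>M) =
          (\<integral>\<^sup>+s. ennreal (sqrt (k t s)) * (ennreal (sqrt (k t s)) * g s) \<partial>M)"
      using sqrt_sq by (simp add: power2_eq_square flip: mult.assoc)
    also have "\<dots>\<^sup>2 \<le> (\<integral>\<^sup>+s. (ennreal (sqrt (k t s)))\<^sup>2 \<partial>M) *
                   (\<integral>\<^sup>+s. (ennreal (sqrt (k t s)) * g s)\<^sup>2 \<partial>M)"
      by (rule Cauchy_Schwarz_nn_integral) auto
    also have "\<dots> = (\<integral>\<^sup>+s. ennreal (k t s) \<partial>M) * (\<integral>\<^sup>+s. ennreal (k t s) * (g s)\<^sup>2 \<partial>M)"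
      by (simp add: power_mult_distrib sqrt_sq)
    also have "\<dots> \<le> ennreal C * (\<integral>\<^sup>+s. ennreal (k t s) * (g s)\<^sup>2 \<partial>M)"
      using k t by (intro mult_right_mono) (auto simp: schur_kernel_def)
    finally show ?thesis .
  qed
  then have "(\<integral>\<^sup>+t. (\<integral>\<^sup>+s. ennreal (k t s) * g s \<partial>M)\<^sup>2 \<partial>M) \<le>
             (\<integral>\<^sup>+t. ennreal C * (\<integral>\<^sup>+s. ennreal (k t s) * (g s)\<^sup>2 \<partial>M) \<partial>M)"
    by (rule nn_integral_mono)
  also have "\<dots> = ennreal C * (\<integral>\<^sup>+t. (\<integral>\<^sup>+s. ennreal (k t s) * (g s)\<^sup>2 \<partial>M) \<partial>M)"
    by (rule nn_integral_cmult) measurable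
  also have "(\<integral>\<^sup>+t. (\<integral>\<^sup>+s. ennreal (k t s) * (g s)\<^sup>2 \<partial>M) \<partial>M) =
             (\<integral>\<^sup>+s. (\<integral>\<^sup>+t. ennreal (k t s) * (g s)\<^sup>2 \<partial>M) \<partial>M)"
  proof -
    interpret pair_sigma_finite M M ..
    show ?thesis by (rule Fubini'[symmetric]) measurable
  qed
  also have "\<dots> \<le> (\<integral>\<^sup>+s. ennreal C * (g s)\<^sup>2 \<partial>M)"
  proof (rule nn_integral_mono)
    fix s assume s: "s \<in> space M"
    have [measurable]: "(\<lambda>t. k t s) \<in> borel_measurable M" using s by measurable
    show "(\<integral>\<^sup>+t. ennreal (k t s) * (g s)\<^sup>2 \<partial>M) \<le> ennreal C * (g s)\<^sup>2"
      using k s by (subst nn_integral_multc) (auto simp: schur_kernel_def intro: mult_right_mono)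
  qed
  also have "\<dots> = ennreal C * (\<integral>\<^sup>+s. (g s)\<^sup>2 \<partial>M)"
    by (rule nn_integral_cmult) measurable
  finally show ?thesis
    by (simp add: power2_eq_square mult.assoc mult_left_mono)
qed

lemma (in sigma_finite_measure) schur_nn_integral_square_finite:
  assumes "schur_kernel M k C" "g \<in> borel_measurable M" "(\<integral>\<^sup>+s. (g s)\<^sup>2 \<partial>M) < \<infinity>"
  shows "(\<integral>\<^sup>+t. (\<integral>\<^sup>+s. ennreal (k t s) * g s \<partial>M)\<^sup>2 \<partial>M) < \<infinity>"
proof -
  have "(ennreal C)\<^sup>2 * (\<integral>\<^sup>+s. (g s)\<^sup>2 \<partial>M) < \<infinity>"
    using assms(3) by (simp add: ennreal_mult_less_top power_less_top_ennreal)
  then show ?thesis using schur_nn_integral_bound[OF assms(1,2)] by (rule order.strict_trans1[rotated])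
qed

lemma (in sigma_finite_measure) schur_nn_integral_AE_finite:
  assumes k: "schur_kernel M k C" and [measurable]: "g \<in> borel_measurable M"
    and "(\<integral>\<^sup>+s. (g s)\<^sup>2 \<partial>M) < \<infinity>"
  shows "AE t in M. (\<integral>\<^sup>+s. ennreal (k t s) * g s \<partial>M) < \<infinity>"
proof -
  have [measurable]: "case_prod k \<in> borel_measurable (M \<Otimes>\<^sub>M M)"
    using k by (auto simp: schur_kernel_def)
  have "AE t in M. (\<integral>\<^sup>+s. ennreal (k t s) * g s \<partial>M)\<^sup>2 \<noteq> \<infinity>"
    by (rule nn_integral_PInf_AE) (use schur_nn_integral_square_finite[OF assms] in auto)
  then show ?thesis
    by eventually_elim (auto simp: less_top power2_eq_square ennreal_mult_eq_top_iff)
qed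

text \<open>The Bochner integral of a non-integrable function is 0 by convention, so the bound holds
  at every t, even where the defining integral diverges.\<close>

lemma (in sigma_finite_measure) schur_kernel_op_bound:
  assumes k: "schur_kernel M k C" and [measurable]: "f \<in> borel_measurable M"
  shows "ennreal \<bar>kernel_op M k f t\<bar> \<le> (\<integral>\<^sup>+s. ennreal (k t s) * ennreal \<bar>f s\<bar> \<partial>M)"
proof (cases "integrable M (\<lambda>s. k t s * f s)")
  case True
  then show ?thesis
    using integral_norm_bound_ennreal[OF True] k
    by (simp add: kernel_op_def abs_mult schur_kernel_def ennreal_mult')
qed (simp add: kernel_op_def not_integrable_integral_eq)

lemma (in sigma_finite_measure) kernel_op_square_integrable:
  assumes k: "schur_kernel M k C" and f: "f \<in> square_integrable M"
  shows "kernel_op M k f \<in> square_integrable M"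
proof -
  have [measurable]: "f \<in> borel_measurable M" "case_prod k \<in> borel_measurable (M \<Otimes>\<^sub>M M)"
    using f k by (auto simp: square_integrable_def schur_kernel_def)
  have "(\<integral>\<^sup>+t. (ennreal \<bar>kernel_op M k f t\<bar>)\<^sup>2 \<partial>M) \<le>
        (\<integral>\<^sup>+t. (\<integral>\<^sup>+s. ennreal (k t s) * ennreal \<bar>f s\<bar> \<partial>M)\<^sup>2 \<partial>M)"
    by (intro nn_integral_mono power_mono schur_kernel_op_bound[OF k]) auto
  also have "\<dots> < \<infinity>"
    by (rule schur_nn_integral_square_finite[OF k])
       (use f in \<open>auto simp: square_integrable_iff_nn_integral\<close>)
  finally show ?thesis
    unfolding square_integrable_iff_nn_integral by (auto simp: kernel_op_def)
qed

text \<open>Fubini's theorem applies because the absolute double integral pairs |f| with the kernel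
  integral of |g|, which is finite by Cauchy-Schwarz and Schur's test.\<close>

lemma (in sigma_finite_measure) kernel_op_adjoint:
  assumes k: "schur_kernel M k C" and f: "f \<in> square_integrable M" and g: "g \<in> square_integrable M"
  shows "(LINT t|M. f t * kernel_op M k g t) = (LINT s|M. kernel_op M (\<lambda>s t. k t s) f s * g s)"
proof -
  interpret P: pair_sigma_finite M M ..
  have [measurable]: "f \<in> borel_measurable M" "g \<in> borel_measurable M"
      "case_prod k \<in> borel_measurable (M \<Otimes>\<^sub>M M)" and k0: "\<And>t s. 0 \<le> k t s"
    using f g k by (auto simp: square_integrable_def schur_kernel_def)
  have "(\<integral>\<^sup>+t. (\<integral>\<^sup>+s. ennreal (norm (f t * (k t s * g s))) \<partial>M) \<partial>M) =
        (\<integral>\<^sup>+t. ennreal \<bar>f t\<bar> * (\<integral>\<^sup>+s. ennreal (k t s) * ennreal \<bar>g s\<bar> \<partial>M) \<partial>M)"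
  proof (rule nn_integral_cong)
    fix t assume t: "t \<in> space M"
    have [measurable]: "k t \<in> borel_measurable M" using t by measurable
    show "(\<integral>\<^sup>+s. ennreal (norm (f t * (k t s * g s))) \<partial>M) =
          ennreal \<bar>f t\<bar> * (\<integral>\<^sup>+s. ennreal (k t s) * ennreal \<bar>g s\<bar> \<partial>M)"
      by (subst nn_integral_cmult[symmetric])
         (auto intro!: nn_integral_cong simp: abs_mult ennreal_mult' k0)
  qed
  also have "\<dots> < \<infinity>"
  proof -
    have "(\<integral>\<^sup>+t. ennreal \<bar>f t\<bar> * (\<integral>\<^sup>+s. ennreal (k t s) * ennreal \<bar>g s\<bar> \<partial>M) \<partial>M)\<^sup>2 \<le>
        (\<integral>\<^sup>+t. (ennreal \<bar>f t\<bar>)\<^sup>2 \<partial>M) *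
        (\<integral>\<^sup>+t. (\<integral>\<^sup>+s. ennreal (k t s) * ennreal \<bar>g s\<bar> \<partial>M)\<^sup>2 \<partial>M)"
      by (rule Cauchy_Schwarz_nn_integral) auto
    also have "\<dots> < \<infinity>"
      using schur_nn_integral_square_finite[OF k, of "\<lambda>s. ennreal \<bar>g s\<bar>"] f g
      by (auto simp: square_integrable_iff_nn_integral ennreal_mult_less_top)
    finally show ?thesis by (simp add: power_less_top_ennreal)
  qed
  finally have "integrable (M \<Otimes>\<^sub>M M) (\<lambda>(t, s). f t * (k t s * g s))"
    unfolding integrable_iff_bounded by (subst nn_integral_fst[symmetric]) auto
  from P.Fubini_integral[OF this]
  have "(LINT t|M. LINT s|M. f t * (k t s * g s)) = (LINT s|M. LINT t|M. k t s * f t * g s)"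
    by (simp add: mult_ac)
  then show ?thesis
    by (simp add: kernel_op_def)
qed

text \<open>The integrals may be exchanged at each t where the iterated integral of absolute values
  is finite. The inner integral of |f| is square integrable by the test for \<open>l\<close>, so the
  test for \<open>k\<close> yields finiteness for almost all t.\<close>

lemma (in sigma_finite_measure) kernel_op_compose_AE:
  assumes k: "schur_kernel M k C" and l: "schur_kernel M l D" and f: "f \<in> square_integrable M"
  shows "AE t in M. kernel_op M k (kernel_op M l f) t =
    kernel_op M (\<lambda>t r. LINT s|M. k t s * l s r) f t"
proof -
  interpret P: pair_sigma_finite M M ..
  have [measurable]: "f \<in> borel_measurable M" "case_prod k \<in> borel_measurable (M \<Otimes>\<^sub>M M)"
      "case_prod l \<in> borel_measurable (M \<Otimes>\<^sub>M M)" and k0: "\<And>t s. 0 \<le> k t s" and l0: "\<And>t s. 0 \<le> l t s"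
    using f k l by (auto simp: square_integrable_def schur_kernel_def)
  have "AE t in M. (\<integral>\<^sup>+s. ennreal (k t s) * (\<integral>\<^sup>+r. ennreal (l s r) * ennreal \<bar>f r\<bar> \<partial>M) \<partial>M) < \<infinity>"
    by (intro schur_nn_integral_AE_finite[OF k] schur_nn_integral_square_finite[OF l])
       (use f in \<open>auto simp: square_integrable_iff_nn_integral\<close>)
  then show ?thesis using AE_space
  proof eventually_elim
    fix t assume fin: "(\<integral>\<^sup>+s. ennreal (k t s) * (\<integral>\<^sup>+r. ennreal (l s r) * ennreal \<bar>f r\<bar> \<partial>M) \<partial>M) < \<infinity>"
      and t: "t \<in> space M"
    have [measurable]: "k t \<in> borel_measurable M" using t by measurable
    have "(\<integral>\<^sup>+s. (\<integral>\<^sup>+r. ennreal (norm (k t s * (l s r * f r))) \<partial>M) \<partial>M) =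
          (\<integral>\<^sup>+s. ennreal (k t s) * (\<integral>\<^sup>+r. ennreal (l s r) * ennreal \<bar>f r\<bar> \<partial>M) \<partial>M)"
    proof (rule nn_integral_cong)
      fix s assume s: "s \<in> space M"
      have [measurable]: "l s \<in> borel_measurable M" using s by measurable
      show "(\<integral>\<^sup>+r. ennreal (norm (k t s * (l s r * f r))) \<partial>M) =
            ennreal (k t s) * (\<integral>\<^sup>+r. ennreal (l s r) * ennreal \<bar>f r\<bar> \<partial>M)"
        by (subst nn_integral_cmult[symmetric])
           (auto intro!: nn_integral_cong simp: abs_mult ennreal_mult' k0 l0)
    qed
    with fin have "integrable (M \<Otimes>\<^sub>M M) (\<lambda>(s, r). k t s * (l s r * f r))"
      unfolding integrable_iff_bounded by (subst nn_integral_fst[symmetric]) auto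
    from P.Fubini_integral[OF this]
    have "(LINT s|M. LINT r|M. k t s * (l s r * f r)) = (LINT r|M. LINT s|M. k t s * l s r * f r)"
      by (simp add: mult.assoc)
    then show "kernel_op M k (kernel_op M l f) t = kernel_op M (\<lambda>t r. LINT s|M. k t s * l s r) f t"
      by (simp add: kernel_op_def)
  qed
qed

lemma square_integrable_Cauchy_Schwarz:
  assumes f: "f \<in> square_integrable M" and g: "g \<in> square_integrable M"
  shows "(LINT x|M. f x * g x)\<^sup>2 \<le> (LINT x|M. (f x)\<^sup>2) * (LINT x|M. (g x)\<^sup>2)"
proof -
  have [measurable]: "f \<in> borel_measurable M" "g \<in> borel_measurable M"
    and int: "integrable M (\<lambda>x. (f x)\<^sup>2)" "integrable M (\<lambda>x. (g x)\<^sup>2)"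
    using f g by (auto simp: square_integrable_def)
  have "ennreal \<bar>LINT x|M. f x * g x\<bar> \<le> (\<integral>\<^sup>+x. ennreal \<bar>f x\<bar> * ennreal \<bar>g x\<bar> \<partial>M)"
    using integral_norm_bound_ennreal[OF integrable_mult_square_integrable[OF f g]]
    by (simp add: abs_mult ennreal_mult')
  then have "(ennreal \<bar>LINT x|M. f x * g x\<bar>)\<^sup>2 \<le> (\<integral>\<^sup>+x. ennreal \<bar>f x\<bar> * ennreal \<bar>g x\<bar> \<partial>M)\<^sup>2"
    by (intro power_mono) auto
  also have "\<dots> \<le> (\<integral>\<^sup>+x. (ennreal \<bar>f x\<bar>)\<^sup>2 \<partial>M) * (\<integral>\<^sup>+x. (ennreal \<bar>g x\<bar>)\<^sup>2 \<partial>M)"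
    by (rule Cauchy_Schwarz_nn_integral) auto
  also have "\<dots> = ennreal ((LINT x|M. (f x)\<^sup>2) * (LINT x|M. (g x)\<^sup>2))"
    by (simp add: ennreal_power nn_integral_eq_integral int ennreal_mult')
  finally show ?thesis
    by (simp add: ennreal_power)
qed

section \<open>Spectral characteristics of compositions\<close>

lemma L2_space_eq: "L2_space T = square_integrable (restrict_space lborel {0..T})"
  unfolding L2_space_def square_integrable_def set_borel_measurable_def set_integrable_def
  by (simp add: borel_measurable_restrict_space_iff integrable_restrict_space)

lemma L2_inner_eq: "L2_inner T f g = (LINT t|restrict_space lborel {0..T}. f t * g t)"
  unfolding L2_inner_def set_lebesgue_integral_def by (simp add: integral_restrict_space)

text \<open>Parseval's identity from completeness: the n-th partial sum misses the inner product by
  exactly (f, r n), with r n the remainder of the expansion of g, and Cauchy-Schwarz reduces this to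
  the norm of r n, which tends to 0.\<close>

lemma L2_orthonormal_basis_sums_inner:
  assumes q: "L2_orthonormal_basis T q" and f: "f \<in> L2_space T" and g: "g \<in> L2_space T"
  shows "(\<lambda>k. L2_inner T f (q k) * L2_inner T (q k) g) sums L2_inner T f g"
proof -
  let ?M = "restrict_space lborel {0..T}"
  define r where "r n = (\<lambda>t. g t + (\<Sum>i<n. - L2_inner T (q i) g * q i t))" for n
  have f': "f \<in> square_integrable ?M" and g': "g \<in> square_integrable ?M"
    and q': "\<And>i. q i \<in> square_integrable ?M"
    using f g q by (auto simp: L2_space_eq L2_orthonormal_basis_def)
  have r: "r n \<in> square_integrable ?M" for n
    unfolding r_def
    by (intro square_integrable_add square_integrable_sum square_integrable_scale g' q')
  have fr: "L2_inner T f (r n) =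
      L2_inner T f g - (\<Sum>k<n. L2_inner T f (q k) * L2_inner T (q k) g)" for n
  proof -
    have "L2_inner T f (r n) =
        (LINT t|?M. f t * g t + (\<Sum>i<n. - L2_inner T (q i) g * (f t * q i t)))"
      unfolding L2_inner_eq[of T f "r n"] unfolding r_def
      by (intro Bochner_Integration.integral_cong refl)
         (simp add: distrib_left sum_distrib_left mult.left_commute right_diff_distrib sum_negf)
    also have "\<dots> = (LINT t|?M. f t * g t) +
        (\<Sum>i<n. - L2_inner T (q i) g * (LINT t|?M. f t * q i t))"
      by (simp add: integrable_mult_square_integrable f' g' q' sum_negf)
    finally show ?thesis
      by (simp add: L2_inner_eq sum_negf mult.commute)
  qed
  have "(\<lambda>n. LBINT t:{0..T}. (g t - (\<Sum>i<n. L2_inner T (q i) g * q i t))\<^sup>2) \<longlonglongrightarrow> 0"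
    using q g by (auto simp: L2_orthonormal_basis_def)
  then have "(\<lambda>n. LINT t|?M. (r n t)\<^sup>2) \<longlonglongrightarrow> 0"
    by (simp add: r_def sum_negf set_lebesgue_integral_def integral_restrict_space)
  then have "(\<lambda>n. (LINT t|?M. (f t)\<^sup>2) * (LINT t|?M. (r n t)\<^sup>2)) \<longlonglongrightarrow> 0"
    by (rule tendsto_mult_right_zero)
  then have "(\<lambda>n. (L2_inner T f (r n))\<^sup>2) \<longlonglongrightarrow> 0"
    by (rule tendsto_sandwich[OF _ _ tendsto_const, rotated 2])
       (auto simp: L2_inner_eq intro!: always_eventually square_integrable_Cauchy_Schwarz f' r)
  then have "(\<lambda>n. L2_inner T f (r n)) \<longlonglongrightarrow> 0"
    by (simp add: tendsto_null_power)
  then have "(\<lambda>n. L2_inner T f g - L2_inner T f (r n)) \<longlonglongrightarrow> L2_inner T f g - 0"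
    by (intro tendsto_intros)
  then show ?thesis
    by (simp add: sums_def fr)
qed

text \<open>Stands in for boundedness on the whole space: it lets L move to the left side of the
  inner product, as the matrix product requires, and passes to compositions without any operator
  norm.\<close>

definition has_adjoint :: "real \<Rightarrow> ((real \<Rightarrow> real) \<Rightarrow> real \<Rightarrow> real) \<Rightarrow> bool" where
  "has_adjoint T L \<longleftrightarrow> (\<forall>f\<in>L2_space T. L f \<in> L2_space T) \<and>
     (\<exists>L'. \<forall>f\<in>L2_space T. L' f \<in> L2_space T \<and>
        (\<forall>g\<in>L2_space T. L2_inner T f (L g) = L2_inner T (L' f) g))"

lemma has_adjoint_id: "has_adjoint T id"
  unfolding has_adjoint_def by (auto intro!: exI[of _ id])

lemma has_adjoint_comp:
  assumes "has_adjoint T L" "has_adjoint T R"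
  shows "has_adjoint T (L \<circ> R)"
proof -
  obtain L' where L': "\<And>f. f \<in> L2_space T \<Longrightarrow> L' f \<in> L2_space T"
      "\<And>f g. f \<in> L2_space T \<Longrightarrow> g \<in> L2_space T \<Longrightarrow> L2_inner T f (L g) = L2_inner T (L' f) g"
    using assms(1) by (auto simp: has_adjoint_def)
  obtain R' where R': "\<And>f. f \<in> L2_space T \<Longrightarrow> R' f \<in> L2_space T"
      "\<And>f g. f \<in> L2_space T \<Longrightarrow> g \<in> L2_space T \<Longrightarrow> L2_inner T f (R g) = L2_inner T (R' f) g"
    using assms(2) by (auto simp: has_adjoint_def)
  show ?thesis
    unfolding has_adjoint_def using assms
    by (auto simp: has_adjoint_def L' R' intro!: exI[of _ "R' \<circ> L'"])
qed

lemma has_adjoint_foldr_comp: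
  "(\<And>L. L \<in> set Ls \<Longrightarrow> has_adjoint T L) \<Longrightarrow> has_adjoint T (foldr (\<circ>) Ls id)"
  by (induction Ls) (auto simp: has_adjoint_id intro!: has_adjoint_comp)

text \<open>The fold applies the last operator first, so the list order is that of the matrix
  factors; associativity of composition enters here.\<close>

lemma foldr_comp_append: "foldr (\<circ>) (Ls @ Rs) id = foldr (\<circ>) Ls id \<circ> foldr (\<circ>) Rs id"
  by (induction Ls) (auto simp: comp_assoc)

context
  fixes T :: real and q :: "nat \<Rightarrow> real \<Rightarrow> real"
  assumes q: "L2_orthonormal_basis T q"
begin

text \<open>Row i of the left matrix holds the coefficients of L' (q i), because (q i, L (q k)) =
  (L' (q i), q k). The series is thus Parseval's identity for L' (q i) and R (q j).\<close>

lemma spectral_characteristic_sums_comp: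
  assumes L: "has_adjoint T L" and R: "R (q j) \<in> L2_space T"
  shows "(\<lambda>k. spectral_characteristic T q L i k * spectral_characteristic T q R k j) sums
    spectral_characteristic T q (L \<circ> R) i j"
proof -
  have q_in: "q k \<in> L2_space T" for k
    using q by (auto simp: L2_orthonormal_basis_def)
  obtain L' where L': "\<And>f. f \<in> L2_space T \<Longrightarrow> L' f \<in> L2_space T"
      "\<And>f g. f \<in> L2_space T \<Longrightarrow> g \<in> L2_space T \<Longrightarrow> L2_inner T f (L g) = L2_inner T (L' f) g"
    using L by (auto simp: has_adjoint_def)
  show ?thesis
    using L2_orthonormal_basis_sums_inner[OF q L'(1)[OF q_in] R]
    by (simp add: spectral_characteristic_def L'(2) q_in R)
qed

lemma spectral_characteristic_comp:
  assumes "has_adjoint T L" "\<And>j. R (q j) \<in> L2_space T"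
  shows "inf_mult_converges (spectral_characteristic T q L) (spectral_characteristic T q R)"
    and "spectral_characteristic T q L \<star> spectral_characteristic T q R =
      spectral_characteristic T q (L \<circ> R)"
  using spectral_characteristic_sums_comp[of L R, OF assms]
  by (auto simp: inf_mult_converges_def inf_mult_def sums_iff)

text \<open>Bracketings agree because each block is the matrix of the composed operators. Any cut
  leaves the last factor in the right block, so the composition of the left block has an adjoint and
  the two-factor case applies.\<close>

lemma bracketing_invariant_spectral_characteristic:
  assumes "Ls \<noteq> []" "\<And>L. L \<in> set (butlast Ls) \<Longrightarrow> has_adjoint T L"
    and "\<And>j. last Ls (q j) \<in> L2_space T"
  shows "bracketing_invariant (map (spectral_characteristic T q) Ls)
    (spectral_characteristic T q (foldr (\<circ>) Ls id))"
  using assms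
proof (induction "length Ls" arbitrary: Ls rule: less_induct)
  case less
  show ?case
  proof (cases "length Ls = 1")
    case True
    then obtain L where "Ls = [L]" by (auto simp: length_Suc_conv)
    then show ?thesis by (simp add: bracketing_invariant.single)
  next
    case False
    with less.prems(1) have len: "2 \<le> length Ls"
      by (cases Ls; cases "tl Ls") auto
    have "\<exists>L R. bracketing_invariant (take n (map (spectral_characteristic T q) Ls)) L \<and>
        bracketing_invariant (drop n (map (spectral_characteristic T q) Ls)) R \<and>
        inf_mult_converges L R \<and> L \<star> R = spectral_characteristic T q (foldr (\<circ>) Ls id)"
      if n: "0 < n" "n < length Ls" for n
    proof -
      have take_adj: "has_adjoint T L" if "L \<in> set (take n Ls)" for L
      proof -
        have "take n Ls = take n (butlast Ls)"
          using n by (simp add: take_butlast)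
        then show ?thesis using that less.prems(2) by (metis in_set_takeD)
      qed
      \<comment> \<open>The last operator of the left block is not the last of \<open>Ls\<close>; it
        has an adjoint and so maps the basis into the space, as the induction hypothesis
        demands.\<close>
      have last_take: "last (take n Ls) (q j) \<in> L2_space T" for j
      proof -
        have "take n Ls \<noteq> []" using n less.prems(1) by auto
        then have "has_adjoint T (last (take n Ls))" using take_adj by (intro take_adj last_in_set)
        then show ?thesis
          using q by (auto simp: has_adjoint_def L2_orthonormal_basis_def)
      qed
      have comp_in: "foldr (\<circ>) Rs id (q j) \<in> L2_space T"
        if "Rs \<noteq> []" "\<And>L. L \<in> set (butlast Rs) \<Longrightarrow> has_adjoint T L"
          "\<And>j. last Rs (q j) \<in> L2_space T" for Rs j
      proof -
        have "foldr (\<circ>) Rs id = foldr (\<circ>) (butlast Rs) id \<circ> last Rs"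
          using that(1) foldr_comp_append[of "butlast Rs" "[last Rs]"] by simp
        moreover have "has_adjoint T (foldr (\<circ>) (butlast Rs) id)"
          using that(2) by (rule has_adjoint_foldr_comp)
        ultimately show ?thesis using that(3) by (auto simp: has_adjoint_def)
      qed
      have drop: "drop n Ls \<noteq> []" "last (drop n Ls) = last Ls"
          "\<And>L. L \<in> set (butlast (drop n Ls)) \<Longrightarrow> has_adjoint T L"
        using n less.prems(2) by (auto simp: butlast_drop dest: in_set_dropD)
      have "bracketing_invariant (map (spectral_characteristic T q) (take n Ls))
          (spectral_characteristic T q (foldr (\<circ>) (take n Ls) id))"
        using n less.prems(1) take_adj last_take
        by (intro less.hyps) (auto dest: in_set_butlastD)
      moreover have "bracketing_invariant (map (spectral_characteristic T q) (drop n Ls))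
          (spectral_characteristic T q (foldr (\<circ>) (drop n Ls) id))"
        using n less.prems(3) drop by (intro less.hyps) auto
      moreover have "has_adjoint T (foldr (\<circ>) (take n Ls) id)"
        using take_adj by (rule has_adjoint_foldr_comp)
      moreover have "foldr (\<circ>) (drop n Ls) id (q j) \<in> L2_space T" for j
        using drop less.prems(3) by (intro comp_in) auto
      moreover note comp = spectral_characteristic_comp[where R = "foldr (\<circ>) (drop n Ls) id", OF calculation(3,4)]
      moreover have "foldr (\<circ>) (take n Ls) id \<circ> foldr (\<circ>) (drop n Ls) id = foldr (\<circ>) Ls id"
        using foldr_comp_append[of "take n Ls" "drop n Ls"] by simp
      ultimately show ?thesis
        unfolding take_map drop_map by metis
    qed
    then show ?thesis using len by (intro bracketing_invariant.split) auto
  qed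
qed

end

section \<open>Euler's integral for the hypergeometric function\<close>

abbreviation cut_plane :: "complex set" where
  "cut_plane \<equiv> - complex_of_real ` {1..}"

section \<open>Geometry of the cut plane\<close>

lemma open_cut_plane: "open cut_plane"
proof -
  have "closed (complex_of_real ` {1..})"
    by (intro closed_injective_linear_image closed_atLeast)
       (auto simp: linear_iff inj_on_def scaleR_conv_of_real)
  then show ?thesis by (simp add: open_closed)
qed

text \<open>If x z were a real y \<ge> 1, then z = y / x \<ge> 1 would lie on the cut too. This star
  shape gives connectedness and keeps the argument of Euler's integrand inside the domain.\<close>

lemma cut_plane_scale:
  assumes "z \<in> cut_plane" "x \<in> {0..1}"
  shows "of_real x * z \<in> cut_plane"
proof
  assume "of_real x * z \<in> complex_of_real ` {1..}"
  then obtain y where y: "1 \<le> y" "of_real x * z = of_real y" by auto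
  then have "x \<noteq> 0" by auto
  with y have "z = of_real (y / x)" by (simp add: field_simps)
  moreover have "1 \<le> y / x" using y assms \<open>x \<noteq> 0\<close> by (simp add: field_simps)
  ultimately have "z \<in> complex_of_real ` {1..}" by (intro image_eqI[of _ _ "y / x"]) auto
  then show False using assms(1) by simp
qed

lemma connected_cut_plane: "connected cut_plane"
proof -
  have "starlike cut_plane"
    unfolding starlike_def
  proof (intro bexI ballI subsetI)
    fix z w assume z: "z \<in> cut_plane" and "w \<in> closed_segment 0 z"
    then obtain u where "0 \<le> u" "u \<le> 1" "w = of_real u * z"
      by (auto simp: in_segment scaleR_conv_of_real)
    then show "w \<in> cut_plane" using cut_plane_scale[OF z, of u] by auto
  qed auto
  then show ?thesis by (rule starlike_imp_connected)
qed

text \<open>Differentiation under the integral sign by dominated convergence. The weight is merely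
  integrable, since the beta weight may blow up at both endpoints; the majorant comes from a bound
  for the derivative of g on a compact set.\<close>

lemma holomorphic_on_integral_scale:
  fixes w :: "real \<Rightarrow> real" and g :: "complex \<Rightarrow> complex"
  assumes w: "integrable lborel w" and supp: "\<And>x. x \<notin> {0..1} \<Longrightarrow> w x = 0"
    and S: "open S" and star: "\<And>z x. z \<in> S \<Longrightarrow> x \<in> {0..1} \<Longrightarrow> of_real x * z \<in> S"
    and g: "g holomorphic_on S"
  shows "z \<in> S \<Longrightarrow> integrable lborel (\<lambda>x. w x *\<^sub>R g (of_real x * z))"
    and "(\<lambda>z. LINT x|lborel. w x *\<^sub>R g (of_real x * z)) holomorphic_on S"
proof -
  have [measurable]: "w \<in> borel_measurable borel" using w by auto
  \<comment> \<open>Continuity in x is available on {0..1} only; the inserted indicator gives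
    measurability on the whole line without changing the integrand.\<close>
  have w_ind: "w x *\<^sub>R h x = w x *\<^sub>R (indicator {0..1} x *\<^sub>R h x)" for x and h :: "real \<Rightarrow> complex"
    using supp[of x] by (cases "x \<in> {0..1}") auto
  have meas: "(\<lambda>x. w x *\<^sub>R h x) \<in> borel_measurable lborel"
    if "continuous_on {0..1} h" for h :: "real \<Rightarrow> complex"
  proof -
    have "(\<lambda>x. indicator {0..1} x *\<^sub>R h x) \<in> borel_measurable borel"
      using that by (intro borel_measurable_continuous_on_indicator) auto
    then have "(\<lambda>x. w x *\<^sub>R (indicator {0..1} x *\<^sub>R h x)) \<in> borel_measurable lborel"
      by measurable
    then show ?thesis by (subst w_ind)
  qed
  have cont: "continuous_on {0..1} (\<lambda>x. h (of_real x * z))"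
    if "continuous_on S h" "z \<in> S" for h :: "complex \<Rightarrow> complex" and z
    by (rule continuous_on_compose2[OF that(1)]) (use that star in \<open>auto intro!: continuous_intros\<close>)
  have g_cont: "continuous_on S g" using g by (rule holomorphic_on_imp_continuous_on)
  have g'_cont: "continuous_on S (deriv g)"
    using g S by (intro holomorphic_on_imp_continuous_on holomorphic_deriv)
  show int: "integrable lborel (\<lambda>x. w x *\<^sub>R g (of_real x * z))" if z: "z \<in> S" for z
  proof -
    have "compact ((\<lambda>x. g (of_real x * z)) ` {0..1})"
      by (intro compact_continuous_image cont g_cont z) auto
    then obtain B where B: "\<And>x. x \<in> {0..1} \<Longrightarrow> norm (g (of_real x * z)) \<le> B"
      by (meson compact_imp_bounded bounded_iff imageI)
    show ?thesis
    proof (rule Bochner_Integration.integrable_bound[where f = "\<lambda>x. B * w x"])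
      show "AE x in lborel. norm (w x *\<^sub>R g (of_real x * z)) \<le> norm (B * w x)"
      proof (rule AE_I2)
        fix x
        show "norm (w x *\<^sub>R g (of_real x * z)) \<le> norm (B * w x)"
          using B[of x] supp[of x] mult_left_mono[of "norm (g (of_real x * z))" "\<bar>B\<bar>" "\<bar>w x\<bar>"]
          by (cases "x \<in> {0..1}") (auto simp: abs_mult mult.commute)
      qed
    qed (use w meas[OF cont[OF g_cont z]] in auto)
  qed
  have "((\<lambda>z. LINT x|lborel. w x *\<^sub>R g (of_real x * z)) has_field_derivative
      (LINT x|lborel. w x *\<^sub>R (of_real x * deriv g (of_real x * z)))) (at z)" if z: "z \<in> S" for z
  proof -
    obtain r where r: "0 < r" "cball z r \<subseteq> S"
      using S z open_contains_cball by blast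
    \<comment> \<open>The compact set of all points x u with x in [0, 1] and u near z. A bound B for
      the derivative of g there bounds the difference quotients uniformly in x, hence the majorant B
      |w|.\<close>
    define K where "K = (\<lambda>(x, u). complex_of_real x * u) ` ({0..1} \<times> cball z r)"
    have "compact K"
      unfolding K_def
      by (intro compact_continuous_image compact_Times)
         (auto intro!: continuous_intros simp: split_beta)
    moreover have "K \<subseteq> S"
      unfolding K_def using r star by auto
    ultimately have "compact (deriv g ` K)"
      using continuous_on_subset[OF g'_cont] by (blast intro: compact_continuous_image)
    then obtain B where B: "\<And>u. u \<in> K \<Longrightarrow> norm (deriv g u) \<le> B"
      by (meson compact_imp_bounded bounded_iff imageI)
    have B0: "0 \<le> B"
    proof -
      have "0 \<in> K" unfolding K_def using r by (auto intro!: image_eqI[of _ _ "(0, z)"])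
      then show ?thesis using B norm_ge_zero order_trans by blast
    qed
    have deriv: "((\<lambda>z. g (of_real x * z)) has_field_derivative of_real x * deriv g (of_real x * u)) (at u)"
      if "x \<in> {0..1}" "u \<in> S" for x u
    proof -
      have "(g has_field_derivative deriv g (of_real x * u)) (at (of_real x * u))"
        using star[OF that(2,1)] g S by (rule holomorphic_derivI[rotated 2])
      moreover have "((\<lambda>z. of_real x * z) has_field_derivative of_real x) (at u)"
        by (auto intro!: derivative_eq_intros)
      ultimately have "((\<lambda>z. g (of_real x * z)) has_field_derivative deriv g (of_real x * u) * of_real x) (at u)"
        by (rule DERIV_chain2)
      then show ?thesis by (simp add: mult.commute)
    qed
    have lip: "norm (g (of_real x * u) - g (of_real x * z)) \<le> B * norm (u - z)"
      if x: "x \<in> {0..1}" and u: "u \<in> cball z r" for x u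
    proof (rule field_differentiable_bound[where S = "cball z r" and f = "\<lambda>z. g (of_real x * z)"
          and f' = "\<lambda>u. of_real x * deriv g (of_real x * u)"])
      fix v assume v: "v \<in> cball z r"
      show "((\<lambda>z. g (of_real x * z)) has_field_derivative of_real x * deriv g (of_real x * v))
          (at v within cball z r)"
        using deriv[OF x] v r(2) by (blast intro: has_field_derivative_at_within)
      have "of_real x * v \<in> K" using x v by (auto simp: K_def)
      then show "norm (of_real x * deriv g (of_real x * v)) \<le> B"
        using B x B0 mult_mono[of x 1 "norm (deriv g (of_real x * v))" B] by (auto simp: norm_mult)
    qed (use u r in auto)
    show ?thesis
      unfolding has_field_derivative_iff tendsto_at_iff_sequentially
    proof (intro allI impI)
      fix X :: "nat \<Rightarrow> complex"
      assume X: "\<forall>i. X i \<in> UNIV - {z}" "X \<longlonglongrightarrow> z"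
      have "\<forall>\<^sub>F n in sequentially. X n \<in> cball z r"
        using tendstoD[OF X(2) r(1)] by eventually_elim (auto simp: dist_commute less_imp_le)
      then obtain N where N: "\<And>n. n \<ge> N \<Longrightarrow> X n \<in> cball z r"
        by (auto simp: eventually_sequentially)
      \<comment> \<open>Dropping the first N terms puts the whole sequence into the disc where the
        majorant is valid; the shift is undone at the end.\<close>
      define Y where "Y n = X (n + N)" for n
      have Y: "Y n \<in> cball z r" "Y n \<noteq> z" "Y n \<in> S" for n
        using N[of "n + N"] X(1) r(2) by (auto simp: Y_def)
      have Y_lim: "Y \<longlonglongrightarrow> z"
        unfolding Y_def using X(2) by (rule LIMSEQ_ignore_initial_segment)
      let ?Q = "\<lambda>n x. w x *\<^sub>R ((g (of_real x * Y n) - g (of_real x * z)) / (Y n - z))"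
      have "(\<lambda>n. LINT x|lborel. ?Q n x) \<longlonglongrightarrow>
          (LINT x|lborel. w x *\<^sub>R (of_real x * deriv g (of_real x * z)))"
      proof (rule integral_dominated_convergence[where w = "\<lambda>x. B * \<bar>w x\<bar>"])
        show "(\<lambda>x. w x *\<^sub>R (of_real x * deriv g (of_real x * z))) \<in> borel_measurable lborel"
          by (intro meas continuous_intros cont g'_cont z)
        show "?Q n \<in> borel_measurable lborel" for n
          using Y by (intro meas continuous_intros cont g_cont z) auto
        show "AE x in lborel. (\<lambda>n. ?Q n x) \<longlonglongrightarrow> w x *\<^sub>R (of_real x * deriv g (of_real x * z))"
        proof (rule AE_I2)
          fix x
          show "(\<lambda>n. ?Q n x) \<longlonglongrightarrow> w x *\<^sub>R (of_real x * deriv g (of_real x * z))"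
          proof (cases "x \<in> {0..1}")
            case True
            have "((\<lambda>u. (g (of_real x * u) - g (of_real x * z)) / (u - z)) \<longlongrightarrow>
                of_real x * deriv g (of_real x * z)) (at z)"
              using deriv[OF True z] by (simp add: has_field_derivative_iff)
            then have "(\<lambda>n. (g (of_real x * Y n) - g (of_real x * z)) / (Y n - z)) \<longlonglongrightarrow>
                of_real x * deriv g (of_real x * z)"
              using Y Y_lim by (auto simp: tendsto_at_iff_sequentially o_def)
            then show ?thesis by (intro tendsto_intros)
          qed (simp add: supp)
        qed
        show "AE x in lborel. norm (?Q n x) \<le> B * \<bar>w x\<bar>" for n
        proof (rule AE_I2)
          fix x
          show "norm (?Q n x) \<le> B * \<bar>w x\<bar>"
          proof (cases "x \<in> {0..1}")
            case True
            have "norm ((g (of_real x * Y n) - g (of_real x * z)) / (Y n - z)) \<le> B"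
              using lip[OF True Y(1)] Y(2) by (simp add: norm_divide divide_simps)
            then show ?thesis
              unfolding norm_scaleR mult.commute[of B] by (rule mult_left_mono) simp
          qed (simp add: supp)
        qed
      qed (use w in auto)
      also have "(\<lambda>n. LINT x|lborel. ?Q n x) = (\<lambda>n. ((LINT x|lborel. w x *\<^sub>R g (of_real x * Y n)) -
          (LINT x|lborel. w x *\<^sub>R g (of_real x * z))) / (Y n - z))"
      proof
        fix n
        have "(LINT x|lborel. ?Q n x) =
            (LINT x|lborel. (w x *\<^sub>R g (of_real x * Y n) - w x *\<^sub>R g (of_real x * z)) / (Y n - z))"
          by (intro Bochner_Integration.integral_cong refl) (simp add: scaleR_conv_of_real right_diff_distrib diff_divide_distrib)
        then show "(LINT x|lborel. ?Q n x) = ((LINT x|lborel. w x *\<^sub>R g (of_real x * Y n)) -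
            (LINT x|lborel. w x *\<^sub>R g (of_real x * z))) / (Y n - z)"
          using int[OF Y(3)] int[OF z] by simp
      qed
      finally show "((\<lambda>y. ((LINT x|lborel. w x *\<^sub>R g (of_real x * y)) -
          (LINT x|lborel. w x *\<^sub>R g (of_real x * z))) / (y - z)) \<circ> X) \<longlonglongrightarrow>
          (LINT x|lborel. w x *\<^sub>R (of_real x * deriv g (of_real x * z)))"
        unfolding Y_def o_def by (rule LIMSEQ_offset)
    qed
  qed
  then show "(\<lambda>z. LINT x|lborel. w x *\<^sub>R g (of_real x * z)) holomorphic_on S"
    using S by (auto simp: holomorphic_on_open)
qed

text \<open>F is used twice: it makes the property under \<open>SOME\<close> satisfiable, so the
  chosen function has it, and it agrees with the chosen function on the unit disc, hence on the cut
  plane by the identity theorem.\<close>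

lemma gauss_2F1_eqI:
  assumes F: "F holomorphic_on cut_plane"
    and series: "\<And>z. z \<in> ball 0 1 \<Longrightarrow> F z = eval_fps (fps_hypergeo [a, b] [c] 1) z"
    and z: "z \<in> cut_plane"
  shows "gauss_2F1 a b c z = F z"
proof -
  let ?P = "\<lambda>F. F holomorphic_on cut_plane \<and>
    (\<forall>z\<in>ball 0 1. F z = eval_fps (fps_hypergeo [a, b] [c] 1) z)"
  have P: "?P (gauss_2F1 a b c)"
    unfolding gauss_2F1_def by (rule someI_ex[of ?P]) (use F series in blast)
  show ?thesis
  proof (rule analytic_continuation_open[where s = "ball 0 1" and s' = cut_plane
        and f = "gauss_2F1 a b c" and g = F])
    show "ball 0 1 \<subseteq> cut_plane" by auto
    show "gauss_2F1 a b c u = F u" if "u \<in> ball 0 1" for u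
      using P series that by simp
  qed (use P F z in \<open>simp_all add: open_cut_plane connected_cut_plane\<close>)
qed

text \<open>The defining property sees a and b only through the symmetric series, so both sides
  choose the same function and the equation holds even on the cut.\<close>

lemma gauss_2F1_commute: "gauss_2F1 a b c = gauss_2F1 b a c"
proof -
  have "fps_hypergeo [a, b] [c] 1 = fps_hypergeo [b, a] [c] 1"
    by (simp add: fps_eq_iff mult.commute)
  then show ?thesis by (simp add: gauss_2F1_def)
qed

definition beta_weight :: "real \<Rightarrow> real \<Rightarrow> real \<Rightarrow> real" where
  "beta_weight b d x = indicator {0..1} x * (x powr (b - 1) * (1 - x) powr (d - 1))"

lemma beta_weight_outside: "x \<notin> {0..1} \<Longrightarrow> beta_weight b d x = 0"
  by (simp add: beta_weight_def)

section \<open>Moments of the beta weight and termwise integration\<close>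

lemma has_bochner_integral_beta_weight:
  assumes "0 < b" "0 < d"
  shows "has_bochner_integral lborel (beta_weight b d) (Beta b d)"
proof -
  have "set_integrable lborel {0..1} (\<lambda>x. x powr (b - 1) * (1 - x) powr (d - 1))"
    by (rule integrable_Beta[OF assms])
  from set_borel_integral_eq_integral[OF this] this show ?thesis
    using integral_unique[OF has_integral_Beta_real[OF assms]]
    by (simp add: has_bochner_integral_iff beta_weight_def[abs_def] set_integrable_def
          set_lebesgue_integral_def)
qed

lemma beta_weight_power: "beta_weight b d x * x ^ n = beta_weight (b + real n) d x"
proof (cases "x \<in> {0<..1}")
  case True
  then have "x powr (b - 1) * x ^ n = x powr (b + real n - 1)"
    by (simp add: powr_realpow[symmetric] powr_add[symmetric] algebra_simps)
  with True show ?thesis by (simp add: beta_weight_def mult_ac)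
next
  case False
  \<comment> \<open>At x = 0 both sides vanish, even for b = 1 and n = 0, because
    \<open>0 powr _\<close> is 0.\<close>
  then show ?thesis by (cases "x = 0") (auto simp: beta_weight_def)
qed

lemma binomial_series_pochhammer:
  fixes a :: real and z :: complex
  assumes "norm z < 1"
  shows "(\<lambda>n. of_real (pochhammer a n / fact n) * z ^ n) sums (1 - z) powr (- of_real a)"
    and "summable (\<lambda>n. norm (of_real (pochhammer a n / fact n) * z ^ n))"
proof -
  have eq: "(- complex_of_real a gchoose n) * (- u) ^ n = of_real (pochhammer a n / fact n) * u ^ n"
    for u n
  proof -
    have "- complex_of_real a gchoose n = (- 1) ^ n * of_real (pochhammer a n / fact n)"
      by (simp add: gbinomial_pochhammer pochhammer_of_real)
    moreover have "(- u) ^ n = (- 1) ^ n * u ^ n"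
      by (rule power_minus)
    ultimately have "(- complex_of_real a gchoose n) * (- u) ^ n =
        ((- 1) ^ n * (- 1) ^ n) * (of_real (pochhammer a n / fact n) * u ^ n)"
      by (simp only: mult_ac)
    also have "(- 1) ^ n * (- 1) ^ n = (1 :: complex)"
      by (simp flip: power_mult_distrib)
    finally show ?thesis by simp
  qed
  have sums: "(\<lambda>n. of_real (pochhammer a n / fact n) * u ^ n) sums (1 - u) powr (- of_real a)"
    if "norm u < 1" for u :: complex
    using gen_binomial_complex[of "- u" "- of_real a"] that by (simp add: eq)
  then show "(\<lambda>n. of_real (pochhammer a n / fact n) * z ^ n) sums (1 - z) powr (- of_real a)"
    using assms by blast
  \<comment> \<open>Its modulus is halfway between |z| and 1: convergence there gives absolute
    convergence at z.\<close>
  let ?r = "of_real ((1 + norm z) / 2) :: complex"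
  have "norm ?r = (1 + norm z) / 2"
    unfolding norm_of_real by simp
  then have "norm ?r < 1" "norm z < norm ?r" using assms by simp_all
  then show "summable (\<lambda>n. norm (of_real (pochhammer a n / fact n) * z ^ n))"
    using sums[THEN sums_summable] by (intro powser_insidea[of _ ?r]) auto
qed

text \<open>The binomial series of (1 - x z) powr (- a) is integrated term by term; x ^ n shifts b
  to b + n in the weight, whence the moments. As x ^ n \<le> 1, the absolutely convergent series at
  z dominates uniformly in x.\<close>

lemma Euler_integral_sums:
  fixes a b d :: real and z :: complex
  assumes b: "0 < b" and d: "0 < d" and z: "norm z < 1"
  shows "(\<lambda>n. of_real (pochhammer a n / fact n * Beta (b + real n) d) * z ^ n) sums
    (LINT x|lborel. beta_weight b d x *\<^sub>R (1 - of_real x * z) powr (- of_real a))"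
proof -
  define c where "c n = complex_of_real (pochhammer a n / fact n)" for n
  define f where "f n x = of_real (beta_weight (b + real n) d x) * (c n * z ^ n)" for n x
  have f_eq: "f n x = beta_weight b d x *\<^sub>R (c n * (of_real x * z) ^ n)" for n x
    by (simp add: f_def beta_weight_power[symmetric] scaleR_conv_of_real power_mult_distrib mult_ac)
  have w_nonneg: "0 \<le> beta_weight b d x" for b x
    by (auto simp: beta_weight_def)
  have f_int: "has_bochner_integral lborel (f n) (of_real (Beta (b + real n) d) * (c n * z ^ n))" for n
    unfolding f_def using has_bochner_integral_beta_weight[of "b + real n" d] b d
    by (intro has_bochner_integral_mult_left has_bochner_integral_of_real) auto
  have norm_f: "norm (f n x) \<le> norm (c n * z ^ n) * beta_weight b d x" for n x
  proof (cases "x \<in> {0..1}")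
    case True
    then have "x ^ n \<le> 1" by (intro power_le_one) auto
    then have "beta_weight b d x * x ^ n * norm (c n * z ^ n) \<le> beta_weight b d x * 1 * norm (c n * z ^ n)"
      using w_nonneg by (intro mult_right_mono mult_left_mono) auto
    then show ?thesis
      using True by (simp add: f_def beta_weight_power[symmetric] norm_mult w_nonneg mult_ac norm_power)
  qed (simp add: f_def beta_weight_def)
  have c_summable: "summable (\<lambda>n. norm (c n * z ^ n))"
    unfolding c_def using z by (rule binomial_series_pochhammer)
  have "(\<lambda>n. integral\<^sup>L lborel (f n)) sums (LINT x|lborel. (\<Sum>n. f n x))"
  proof (rule sums_integral)
    show "integrable lborel (f n)" for n
      using f_int by (auto simp: has_bochner_integral_iff)
    show "AE x in lborel. summable (\<lambda>n. norm (f n x))"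
    proof (rule AE_I2)
      fix x show "summable (\<lambda>n. norm (f n x))"
        by (rule summable_comparison_test'[OF summable_mult2[OF c_summable]]) (use norm_f in auto)
    qed
    show "summable (\<lambda>n. LINT x|lborel. norm (f n x))"
    proof (rule summable_comparison_test'[OF summable_mult2[OF c_summable]])
      fix n
      have "(LINT x|lborel. norm (f n x)) \<le> (LINT x|lborel. norm (c n * z ^ n) * beta_weight b d x)"
        using f_int[of n] has_bochner_integral_beta_weight[OF b d] norm_f
        by (intro integral_mono) (auto simp: has_bochner_integral_iff)
      also have "\<dots> = norm (c n * z ^ n) * Beta b d"
        using has_bochner_integral_beta_weight[OF b d] by (simp add: has_bochner_integral_iff)
      finally show "norm (LINT x|lborel. norm (f n x)) \<le> norm (c n * z ^ n) * Beta b d"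
        by simp
    qed
  qed
  also have "(\<lambda>n. integral\<^sup>L lborel (f n)) =
      (\<lambda>n. of_real (pochhammer a n / fact n * Beta (b + real n) d) * z ^ n)"
    using f_int by (auto simp: has_bochner_integral_iff c_def fun_eq_iff mult_ac)
  also have "(LINT x|lborel. (\<Sum>n. f n x)) =
      (LINT x|lborel. beta_weight b d x *\<^sub>R (1 - of_real x * z) powr (- of_real a))"
  proof (intro Bochner_Integration.integral_cong refl)
    fix x
    show "(\<Sum>n. f n x) = beta_weight b d x *\<^sub>R (1 - of_real x * z) powr (- of_real a)"
    proof (cases "x \<in> {0..1}")
      case True
      then have "norm (of_real x * z) < 1"
        using z mult_mono[of x 1 "norm z" "norm z"] by (simp add: norm_mult)
      from sums_scaleR_right[OF binomial_series_pochhammer(1)[OF this]] show ?thesis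
        unfolding f_eq c_def by (rule sums_unique[symmetric])
    qed (simp add: f_def beta_weight_def)
  qed
  finally show ?thesis .
qed

text \<open>The coefficients match because the quotient of the Pochhammer symbols of b and b + d is
  \<open>Beta (b + real n) d / Beta b d\<close>. The integral continues the series because 1 - x z
  stays off the branch cut of the principal power.\<close>

theorem gauss_2F1_Euler_integral:
  fixes a b d :: real
  assumes b: "0 < b" and d: "0 < d" and z: "z \<in> cut_plane"
  shows "gauss_2F1 (of_real a) (of_real b) (of_real (b + d)) z =
    (LINT x|lborel. beta_weight b d x *\<^sub>R (1 - of_real x * z) powr (- of_real a)) / of_real (Beta b d)"
proof (rule gauss_2F1_eqI[OF _ _ z])
  have Beta_nz: "Beta b d \<noteq> 0"
    using Gamma_real_pos[OF b] Gamma_real_pos[OF d] Gamma_real_pos[OF add_pos_pos[OF b d]]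
    by (simp add: Beta_def)
  have g: "(\<lambda>u. (1 - u) powr (- complex_of_real a)) holomorphic_on cut_plane"
  proof (intro holomorphic_intros)
    fix u assume "u \<in> cut_plane"
    then show "1 - u \<notin> \<real>\<^sub>\<le>\<^sub>0"
    proof (rule contrapos_pn)
      assume "1 - u \<in> \<real>\<^sub>\<le>\<^sub>0"
      then obtain y where "y \<le> 0" "1 - u = of_real y" by (auto simp: nonpos_Reals_def)
      then have "u = of_real (1 - y)" "1 - y \<in> {1..}"
        by (auto simp: algebra_simps)
      then show "\<not> u \<in> cut_plane" by blast
    qed
  qed
  have "(\<lambda>z. LINT x|lborel. beta_weight b d x *\<^sub>R (1 - of_real x * z) powr (- of_real a))
      holomorphic_on cut_plane"
    using has_bochner_integral_beta_weight[OF b d]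
    by (intro holomorphic_on_integral_scale(2)[OF _ _ open_cut_plane cut_plane_scale g])
       (auto simp: has_bochner_integral_iff beta_weight_outside)
  then show "(\<lambda>z. (LINT x|lborel. beta_weight b d x *\<^sub>R (1 - of_real x * z) powr (- of_real a)) /
      of_real (Beta b d)) holomorphic_on cut_plane"
    using Beta_nz by (intro holomorphic_intros) auto
  fix z :: complex assume "z \<in> ball 0 1"
  then have "norm z < 1" by simp
  have coeff: "fps_nth (fps_hypergeo [complex_of_real a, of_real b] [of_real (b + d)] 1) n =
      of_real (pochhammer a n / fact n * Beta (b + real n) d) / of_real (Beta b d)" for n
  proof -
    have poch: "pochhammer s n = Gamma (s + real n) / Gamma s" if "0 < s" for s
      using that by (intro pochhammer_Gamma) (auto elim!: nonpos_Ints_cases)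
    have "pochhammer b n / pochhammer (b + d) n = Beta (b + real n) d / Beta b d"
      using b d Gamma_real_pos[OF b] Gamma_real_pos[OF d] Gamma_real_pos[of "b + d"]
        Gamma_real_pos[of "b + real n"] Gamma_real_pos[of "b + (d + real n)"]
      by (simp add: poch Beta_def divide_simps add_ac del: Gamma_real_pos)
    then have "pochhammer a n * pochhammer b n / (pochhammer (b + d) n * fact n) =
        pochhammer a n / fact n * Beta (b + real n) d / Beta b d"
      by (metis (no_types, opaque_lifting) mult.commute times_divide_eq_left times_divide_times_eq times_divide_eq_right)
    then have "complex_of_real (pochhammer a n * pochhammer b n / (pochhammer (b + d) n * fact n)) =
        of_real (pochhammer a n / fact n * Beta (b + real n) d / Beta b d)"
      by (rule arg_cong)
    then show ?thesis
      by (simp add: pochhammer_of_real flip: of_real_add)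
  qed
  show "(LINT x|lborel. beta_weight b d x *\<^sub>R (1 - of_real x * z) powr (- of_real a)) /
      of_real (Beta b d) = eval_fps (fps_hypergeo [of_real a, of_real b] [of_real (b + d)] 1) z"
    using sums_divide[OF Euler_integral_sums[OF b d \<open>norm z < 1\<close>, of a], of "of_real (Beta b d)"]
    unfolding eval_fps_def coeff by (simp add: sums_iff)
qed

section \<open>Riemann--Liouville operators\<close>

abbreviation lborel_Icc :: "real \<Rightarrow> real measure" where
  "lborel_Icc T \<equiv> restrict_space lborel {0..T}"

section \<open>Lebesgue measure restricted to [0, T]\<close>

lemma sigma_finite_lborel_Icc: "sigma_finite_measure (lborel_Icc T)"
  by (intro sigma_finite_measure_restrict_space) (auto intro: sigma_finite_lborel)

lemma integral_lborel_Icc: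
  "(LINT s|lborel_Icc T. f s) = (LBINT s. indicator {0..T} s * f s)"
  for f :: "real \<Rightarrow> real"
  by (simp add: integral_restrict_space)

lemma measurable_lborel_Icc [measurable (raw)]:
  "f \<in> borel_measurable borel \<Longrightarrow> f \<in> borel_measurable (lborel_Icc T)"
  by (simp add: measurable_restrict_space1)

lemma measurable_pair_lborel_Icc:
  assumes "case_prod k \<in> borel_measurable (borel \<Otimes>\<^sub>M borel)"
  shows "case_prod k \<in> borel_measurable (lborel_Icc T \<Otimes>\<^sub>M lborel_Icc T)"
proof -
  have *: "(\<lambda>x. x) \<in> lborel_Icc T \<rightarrow>\<^sub>M borel"
    by (rule measurable_restrict_space1) simp
  have "(\<lambda>x. (fst x, snd x)) \<in> lborel_Icc T \<Otimes>\<^sub>M lborel_Icc T \<rightarrow>\<^sub>M borel \<Otimes>\<^sub>M borel"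
    using measurable_compose[OF measurable_fst *] measurable_compose[OF measurable_snd *]
    by (rule measurable_Pair)
  from measurable_compose[OF this assms] show ?thesis by (simp add: split_beta')
qed

lemma L2_space_cong:
  assumes "\<And>t. t \<in> {0..T} \<Longrightarrow> f t = g t"
  shows "f \<in> L2_space T \<longleftrightarrow> g \<in> L2_space T"
proof -
  have "f \<in> borel_measurable (lborel_Icc T) \<longleftrightarrow> g \<in> borel_measurable (lborel_Icc T)"
    by (rule measurable_cong) (use assms in simp)
  moreover have "integrable (lborel_Icc T) (\<lambda>t. (f t)\<^sup>2) \<longleftrightarrow> integrable (lborel_Icc T) (\<lambda>t. (g t)\<^sup>2)"
    by (rule Bochner_Integration.integrable_cong) (use assms in simp_all)
  ultimately show ?thesis by (simp add: L2_space_eq square_integrable_def)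
qed

lemma L2_inner_cong:
  assumes "\<And>t. t \<in> {0..T} \<Longrightarrow> f t = f' t" "\<And>t. t \<in> {0..T} \<Longrightarrow> g t = g' t"
  shows "L2_inner T f g = L2_inner T f' g'"
  unfolding L2_inner_eq by (rule Bochner_Integration.integral_cong) (use assms in simp_all)

lemma kernel_op_cong:
  assumes "\<And>s. s \<in> space M \<Longrightarrow> k t s * f s = l t s * g s"
  shows "kernel_op M k f t = kernel_op M l g t"
  unfolding kernel_op_def by (rule Bochner_Integration.integral_cong) (use assms in simp_all)

text \<open>Absorbs the bounded factor s powr b into the kernel of the inner Riemann--Liouville
  operator, so that two operators remain to be composed instead of three.\<close>

lemma schur_kernel_mult_left:
  assumes k: "schur_kernel M k C" and [measurable]: "h \<in> borel_measurable M"
    and h: "\<And>t. 0 \<le> h t" "\<And>t. t \<in> space M \<Longrightarrow> h t \<le> B" and B: "0 \<le> B"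
  shows "schur_kernel M (\<lambda>t s. h t * k t s) (B * C)"
proof -
  have [measurable]: "case_prod k \<in> borel_measurable (M \<Otimes>\<^sub>M M)" and k0: "\<And>t s. 0 \<le> k t s" and C: "0 \<le> C"
    and row: "\<And>t. t \<in> space M \<Longrightarrow> (\<integral>\<^sup>+ s. ennreal (k t s) \<partial>M) \<le> ennreal C"
    and col: "\<And>s. s \<in> space M \<Longrightarrow> (\<integral>\<^sup>+ t. ennreal (k t s) \<partial>M) \<le> ennreal C"
    using k by (auto simp: schur_kernel_def)
  have le: "ennreal (h t * k t s) \<le> ennreal B * ennreal (k t s)" if "t \<in> space M" for t s
    using h that k0 B by (simp add: ennreal_mult'[symmetric] mult_right_mono ennreal_leI)
  have "(\<integral>\<^sup>+ s. ennreal (h t * k t s) \<partial>M) \<le> ennreal (B * C)" if t: "t \<in> space M" for t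
  proof -
    have [measurable]: "k t \<in> borel_measurable M" using t by measurable
    have "(\<integral>\<^sup>+ s. ennreal (h t * k t s) \<partial>M) \<le> (\<integral>\<^sup>+ s. ennreal B * ennreal (k t s) \<partial>M)"
      using le t by (intro nn_integral_mono) auto
    also have "\<dots> \<le> ennreal B * ennreal C"
      by (subst nn_integral_cmult) (auto intro!: mult_left_mono row t)
    finally show ?thesis using B by (simp add: ennreal_mult')
  qed
  moreover have "(\<integral>\<^sup>+ t. ennreal (h t * k t s) \<partial>M) \<le> ennreal (B * C)" if s: "s \<in> space M" for s
  proof -
    have [measurable]: "(\<lambda>t. k t s) \<in> borel_measurable M" using s by measurable
    have "(\<integral>\<^sup>+ t. ennreal (h t * k t s) \<partial>M) \<le> (\<integral>\<^sup>+ t. ennreal B * ennreal (k t s) \<partial>M)"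
      using le by (intro nn_integral_mono) auto
    also have "\<dots> \<le> ennreal B * ennreal C"
      by (subst nn_integral_cmult) (auto intro!: mult_left_mono col s)
    finally show ?thesis using B by (simp add: ennreal_mult')
  qed
  moreover have "case_prod (\<lambda>t s. h t * k t s) \<in> borel_measurable (M \<Otimes>\<^sub>M M)"
    by measurable
  ultimately show ?thesis
    using h k0 B C by (simp add: schur_kernel_def)
qed

lemma schur_kernel_transpose:
  assumes "schur_kernel M k C"
  shows "schur_kernel M (\<lambda>s t. k t s) C"
proof -
  have [measurable]: "case_prod k \<in> borel_measurable (M \<Otimes>\<^sub>M M)"
    using assms by (simp add: schur_kernel_def)
  have "(\<lambda>(s, t). k t s) \<in> borel_measurable (M \<Otimes>\<^sub>M M)"
    by measurable
  with assms show ?thesis by (simp add: schur_kernel_def)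
qed

text \<open>The variable upper limit is moved into the kernel, so that all operators live on the
  fixed interval [0, T]. The value 0 on the diagonal agrees with \<open>0 powr _\<close> being
  0.\<close>

definition rl_kernel :: "real \<Rightarrow> real \<Rightarrow> real \<Rightarrow> real" where
  "rl_kernel \<beta> t s = (if s < t then (t - s) powr (\<beta> - 1) / Gamma \<beta> else 0)"

text \<open>The kernel depends only on t - s, which stays in [0, T] on its support, so every row and
  column integral is at most the integral of x powr (\<beta> - 1) / Gamma \<beta> over [0, T],
  finite as \<beta> > 0.\<close>

lemma schur_kernel_rl_kernel:
  assumes \<beta>: "0 < \<beta>"
  shows "\<exists>C. schur_kernel (lborel_Icc T) (rl_kernel \<beta>) C"
proof -
  define p where "p x = indicator {0..T} x * (x powr (\<beta> - 1) / Gamma \<beta>)" for x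
  have [measurable]: "p \<in> borel_measurable borel" unfolding p_def by measurable
  have \<Gamma>: "0 < Gamma \<beta>" using \<beta> by (rule Gamma_real_pos)
  have p0: "0 \<le> p x" for x using \<Gamma> by (simp add: p_def)
  have p_int: "integrable lborel p"
  proof (cases "0 \<le> T")
    case True
    then have "(\<lambda>x. x powr (\<beta> - 1)) integrable_on {0..T}"
      using \<beta> by (intro integrable_on_powr_from_0) auto
    then have "(\<lambda>x. x powr (\<beta> - 1)) absolutely_integrable_on {0..T}"
      by (subst absolutely_integrable_on_iff_nonneg) auto
    then have "integrable lborel (\<lambda>x. indicator {0..T} x *\<^sub>R x powr (\<beta> - 1))"
      unfolding set_integrable_def by (subst (asm) integrable_completion) auto
    from integrable_divide_zero[OF this, of "Gamma \<beta>"] show ?thesis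
      by (simp add: p_def[abs_def])
  qed (simp add: p_def[abs_def])
  define C where "C = (LINT x|lborel. p x)"
  have C: "(\<integral>\<^sup>+x. ennreal (p x) \<partial>lborel) = ennreal C"
    unfolding C_def using p_int p0 by (intro nn_integral_eq_integral) auto
  have "(\<integral>\<^sup>+ s. ennreal (rl_kernel \<beta> t s) \<partial>lborel_Icc T) \<le> ennreal C" if t: "t \<in> {0..T}" for t
  proof -
    have "(\<integral>\<^sup>+ s. ennreal (rl_kernel \<beta> t s) \<partial>lborel_Icc T) =
        (\<integral>\<^sup>+ s. ennreal (rl_kernel \<beta> t s) * indicator {0..T} s \<partial>lborel)"
      by (rule nn_integral_restrict_space) simp
    also have "\<dots> \<le> (\<integral>\<^sup>+ s. ennreal (p (t + (- 1) * s)) \<partial>lborel)"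
      using t by (intro nn_integral_mono) (auto simp: rl_kernel_def p_def indicator_def)
    also have "\<dots> = (\<integral>\<^sup>+x. ennreal (p x) \<partial>lborel)"
      by (subst nn_integral_real_affine[of "\<lambda>x. ennreal (p x)" "-1" t]) auto
    finally show ?thesis using C by simp
  qed
  moreover have "(\<integral>\<^sup>+ t. ennreal (rl_kernel \<beta> t s) \<partial>lborel_Icc T) \<le> ennreal C"
    if s: "s \<in> {0..T}" for s
  proof -
    have "(\<integral>\<^sup>+ t. ennreal (rl_kernel \<beta> t s) \<partial>lborel_Icc T) =
        (\<integral>\<^sup>+ t. ennreal (rl_kernel \<beta> t s) * indicator {0..T} t \<partial>lborel)"
      by (rule nn_integral_restrict_space) simp
    also have "\<dots> \<le> (\<integral>\<^sup>+ t. ennreal (p (- s + 1 * t)) \<partial>lborel)"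
      using s by (intro nn_integral_mono) (auto simp: rl_kernel_def p_def indicator_def)
    also have "\<dots> = (\<integral>\<^sup>+x. ennreal (p x) \<partial>lborel)"
      by (subst nn_integral_real_affine[of "\<lambda>x. ennreal (p x)" 1 "- s"]) auto
    finally show ?thesis using C by simp
  qed
  moreover have "case_prod (rl_kernel \<beta>) \<in> borel_measurable (lborel_Icc T \<Otimes>\<^sub>M lborel_Icc T)"
    unfolding rl_kernel_def by (rule measurable_pair_lborel_Icc) measurable
  moreover have "0 \<le> C" unfolding C_def using p0 by (intro Bochner_Integration.integral_nonneg)
  ultimately show ?thesis
    using \<Gamma> by (intro exI[of _ C]) (auto simp: schur_kernel_def rl_kernel_def)
qed

lemma riemann_liouville_eq_kernel_op:
  assumes "t \<in> {0..T}"
  shows "riemann_liouville \<beta> f t = kernel_op (lborel_Icc T) (rl_kernel \<beta>) f t"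
proof -
  have "riemann_liouville \<beta> f t =
      (LBINT \<tau>. 1 / Gamma \<beta> * (indicator {0..t} \<tau> * ((t - \<tau>) powr (\<beta> - 1) * f \<tau>)))"
    by (simp add: riemann_liouville_def set_lebesgue_integral_def)
  also have "\<dots> = (LBINT \<tau>. indicator {0..T} \<tau> * (rl_kernel \<beta> t \<tau> * f \<tau>))"
    using assms by (intro Bochner_Integration.integral_cong) (auto simp: rl_kernel_def indicator_def)
  finally show ?thesis
    by (simp add: kernel_op_def integral_lborel_Icc)
qed

text \<open>The adjoint is right-sided fractional integration, given by the transposed
  kernel.\<close>

lemma has_adjoint_riemann_liouville:
  assumes \<beta>: "0 < \<beta>"
  shows "has_adjoint T (riemann_liouville \<beta>)"
proof -
  interpret sigma_finite_measure "lborel_Icc T" by (rule sigma_finite_lborel_Icc)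
  obtain C where C: "schur_kernel (lborel_Icc T) (rl_kernel \<beta>) C"
    using schur_kernel_rl_kernel[OF \<beta>] by blast
  show ?thesis
    unfolding has_adjoint_def
  proof (intro conjI ballI exI[of _ "kernel_op (lborel_Icc T) (\<lambda>s t. rl_kernel \<beta> t s)"])
    fix f assume f: "f \<in> L2_space T"
    show "riemann_liouville \<beta> f \<in> L2_space T"
      using kernel_op_square_integrable[OF C] f
      by (subst L2_space_cong[OF riemann_liouville_eq_kernel_op]) (auto simp: L2_space_eq)
    show "kernel_op (lborel_Icc T) (\<lambda>s t. rl_kernel \<beta> t s) f \<in> L2_space T"
      using kernel_op_square_integrable[OF schur_kernel_transpose[OF C]] f by (simp add: L2_space_eq)
    fix g assume g: "g \<in> L2_space T"
    have "L2_inner T f (riemann_liouville \<beta> g) =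
        L2_inner T f (kernel_op (lborel_Icc T) (rl_kernel \<beta>) g)"
      by (intro L2_inner_cong refl riemann_liouville_eq_kernel_op)
    also have "\<dots> = L2_inner T (kernel_op (lborel_Icc T) (\<lambda>s t. rl_kernel \<beta> t s) f) g"
      using kernel_op_adjoint[OF C] f g by (simp add: L2_space_eq L2_inner_eq)
    finally show "L2_inner T f (riemann_liouville \<beta> g) =
        L2_inner T (kernel_op (lborel_Icc T) (\<lambda>s t. rl_kernel \<beta> t s) f) g" .
  qed
qed

text \<open>Multiplication is its own adjoint. The bound T powr \<alpha> on [0, T] relies on
  \<alpha> \<ge> 0, which excludes the rightmost factor.\<close>

lemma has_adjoint_power_mult_op:
  assumes "0 \<le> \<alpha>"
  shows "has_adjoint T (power_mult_op \<alpha>)"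
proof -
  have "power_mult_op \<alpha> f \<in> L2_space T" if "f \<in> L2_space T" for f
    using that assms unfolding power_mult_op_def L2_space_eq
    by (intro square_integrable_bounded_mult[of _ _ _ "T powr \<alpha>"]) (auto intro!: powr_mono2)
  then show ?thesis
    unfolding has_adjoint_def
    by (auto intro!: exI[of _ "power_mult_op \<alpha>"] simp: L2_inner_def power_mult_op_def mult_ac)
qed

section \<open>The operator of fractional Brownian motion\<close>

text \<open>The two kernels contribute (t - r) to the powers d - 1 and b - 1, and the Jacobian of
  the substitution adds 1.\<close>

lemma rl_kernel_compose:
  assumes b: "0 < b" and d: "0 < d" and r: "0 < r" "r < t" "t \<le> T"
  shows "(LINT s|lborel_Icc T. rl_kernel d t s * (s powr b * rl_kernel b s r)) =
    (t - r) powr (b + d - 1) * r powr b / (Gamma b * Gamma d) *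
      (LINT x|lborel. beta_weight b d x * (1 - x * (1 - t / r)) powr b)"
proof -
  define h where "h s = indicator {0..T} s * (rl_kernel d t s * (s powr b * rl_kernel b s r))" for s
  have "h (r + (t - r) * x) = (t - r) powr (b + d - 2) * r powr b / (Gamma b * Gamma d) *
      (beta_weight b d x * (1 - x * (1 - t / r)) powr b)" for x
  proof (cases "x \<in> {0<..<1}")
    case True
    have upper: "r + (t - r) * x < t"
    proof -
      have "(t - r) * x < (t - r) * 1" using True r by (intro mult_strict_left_mono) auto
      then show ?thesis by simp
    qed
    have lower: "r < r + (t - r) * x" using True r by simp
    have "t - (r + (t - r) * x) = (t - r) * (1 - x)" by (simp add: algebra_simps)
    then have 1: "(t - (r + (t - r) * x)) powr (d - 1) = (t - r) powr (d - 1) * (1 - x) powr (d - 1)"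
      using True r by (simp add: powr_mult)
    have 2: "(r + (t - r) * x) powr b = r powr b * (1 - x * (1 - t / r)) powr b"
    proof -
      \<comment> \<open>The source of the argument 1 - t / r; the factor r powr b left over is later
        cancelled by the rightmost multiplication.\<close>
      have eq: "r + (t - r) * x = r * (1 - x * (1 - t / r))" using r by (simp add: field_simps)
      moreover have "0 \<le> 1 - x * (1 - t / r)"
      proof -
        have "0 < r * (1 - x * (1 - t / r))" using eq lower r by linarith
        then show ?thesis using r by (simp add: zero_less_mult_iff)
      qed
      ultimately show ?thesis using r by (simp add: powr_mult)
    qed
    have 3: "((t - r) * x) powr (b - 1) = (t - r) powr (b - 1) * x powr (b - 1)"
      using True r by (simp add: powr_mult)
    have 4: "(t - r) powr (d - 1) * (t - r) powr (b - 1) = (t - r) powr (b + d - 2)"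
      by (simp add: algebra_simps flip: powr_add)
    have "h (r + (t - r) * x) = (t - r) powr (d - 1) * (1 - x) powr (d - 1) / Gamma d *
        (r powr b * (1 - x * (1 - t / r)) powr b * ((t - r) powr (b - 1) * x powr (b - 1) / Gamma b))"
      using r upper lower by (simp add: h_def rl_kernel_def 1 2 3)
    also have "\<dots> = ((t - r) powr (d - 1) * (t - r) powr (b - 1)) * r powr b / (Gamma b * Gamma d) *
        (x powr (b - 1) * (1 - x) powr (d - 1) * (1 - x * (1 - t / r)) powr b)"
      by (simp add: mult_ac)
    finally show ?thesis using True by (simp add: 4 beta_weight_def)
  next
    case False
    \<comment> \<open>Here s \<le> r or s \<ge> t, so one of the two kernels vanishes.\<close>
    have "h (r + (t - r) * x) = 0"
    proof (cases "x \<le> 0")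
      case True
      then have "(t - r) * x \<le> 0" using r by (simp add: mult_nonneg_nonpos)
      then show ?thesis by (simp add: h_def rl_kernel_def)
    next
      case x: False
      then have "(t - r) * 1 \<le> (t - r) * x" using False r by (intro mult_left_mono) auto
      then show ?thesis by (simp add: h_def rl_kernel_def)
    qed
    moreover have "beta_weight b d x = 0"
      using False by (cases "x = 0"; cases "x = 1") (auto simp: beta_weight_def)
    ultimately show ?thesis by simp
  qed
  then have "(LBINT s. h s) = (t - r) * ((t - r) powr (b + d - 2) * r powr b / (Gamma b * Gamma d) *
      (LBINT x. beta_weight b d x * (1 - x * (1 - t / r)) powr b))"
    using r by (subst lborel_integral_real_affine[where c = "t - r" and t = r]) auto
  also have "\<dots> = (t - r) powr 1 * (t - r) powr (b + d - 2) * r powr b / (Gamma b * Gamma d) *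
      (LBINT x. beta_weight b d x * (1 - x * (1 - t / r)) powr b)"
    using r by simp
  also have "(t - r) powr 1 * (t - r) powr (b + d - 2) = (t - r) powr (b + d - 1)"
    unfolding powr_add[symmetric] by simp
  finally show ?thesis by (simp add: integral_lborel_Icc h_def)
qed

text \<open>With first parameter - b, Euler's integrand carries the power b of 1 - x z, a
  nonnegative real for z < 0 and x in [0, 1]; there the complex power is the real one.\<close>

lemma Re_gauss_2F1_negative:
  assumes b: "0 < b" and d: "0 < d" and z: "z < 0"
  shows "Re (gauss_2F1 (of_real (- b)) (of_real b) (of_real (b + d)) (of_real z)) =
    (LINT x|lborel. beta_weight b d x * (1 - x * z) powr b) / Beta b d"
proof -
  have "complex_of_real z \<in> cut_plane" using z by auto
  from gauss_2F1_Euler_integral[OF b d this, of "- b"]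
  have "gauss_2F1 (of_real (- b)) (of_real b) (of_real (b + d)) (of_real z) =
      (LINT x|lborel. beta_weight b d x *\<^sub>R (1 - of_real x * complex_of_real z) powr of_real b) / of_real (Beta b d)"
    by simp
  also have "(LINT x|lborel. beta_weight b d x *\<^sub>R (1 - of_real x * complex_of_real z) powr of_real b) =
      (LINT x|lborel. complex_of_real (beta_weight b d x * (1 - x * z) powr b))"
  proof (intro Bochner_Integration.integral_cong refl)
    fix x
    show "beta_weight b d x *\<^sub>R (1 - of_real x * complex_of_real z) powr of_real b =
        complex_of_real (beta_weight b d x * (1 - x * z) powr b)"
    proof (cases "x \<in> {0..1}")
      case True
      then have "0 \<le> 1 - x * z" using z by (simp add: mult_nonneg_nonpos order_trans[of _ 0])
      then have "complex_of_real (1 - x * z) powr of_real b = of_real ((1 - x * z) powr b)"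
        by (rule powr_of_real)
      then show ?thesis by (simp add: scaleR_conv_of_real)
    qed (simp add: beta_weight_outside)
  qed
  also have "\<dots> = of_real (LINT x|lborel. beta_weight b d x * (1 - x * z) powr b)"
    by (rule integral_complex_of_real)
  finally show ?thesis by (simp flip: of_real_divide)
qed

text \<open>Since \<open>Gamma (b + d) * Beta b d\<close> equals \<open>Gamma b * Gamma d\<close>,
  the normalisation of the kernel is that of the two Riemann--Liouville kernels.\<close>

lemma fbm_kernel_eq_compose:
  assumes b: "b = \<bar>H - 1/2\<bar>" "0 < b" and d: "0 < d" "b + d = H + 1/2" and "r \<in> {0..T}" "t \<in> {0..T}"
  shows "fbm_kernel H t r = fbm_const H *
    (LINT s|lborel_Icc T. rl_kernel d t s * (s powr b * rl_kernel b s r)) * r powr (- b)"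
proof (cases "0 < r \<and> r < t")
  case True
  have F: "gauss_2F1 (of_real (1/2 - H)) (of_real (H - 1/2)) (of_real (H + 1/2)) =
      gauss_2F1 (of_real (- b)) (of_real b) (of_real (b + d))"
  proof (cases "H < 1/2")
    case True
    then have "1/2 - H = b" "H - 1/2 = - b" using b by auto
    then show ?thesis unfolding d(2) by (metis gauss_2F1_commute)
  next
    case False
    then have "1/2 - H = - b" "H - 1/2 = b" using b by auto
    then show ?thesis unfolding d(2) by metis
  qed
  define I where "I = (LINT x|lborel. beta_weight b d x * (1 - x * (1 - t / r)) powr b)"
  have "1 - t / r < 0" using True by simp
  then have "Re (gauss_2F1 (of_real (1/2 - H)) (of_real (H - 1/2)) (of_real (H + 1/2)) (of_real (1 - t / r))) =
      I / Beta b d"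
    unfolding F I_def by (rule Re_gauss_2F1_negative[OF b(2) d(1)])
  then have "fbm_kernel H t r =
      fbm_const H / Gamma (b + d) * (t - r) powr (H - 1/2) * (I / Beta b d)"
    using True d(2) by (simp add: fbm_kernel_def)
  also have "H - 1/2 = b + d - 1" using d by simp
  finally have "fbm_kernel H t r =
      fbm_const H * (t - r) powr (b + d - 1) * I / (Gamma b * Gamma d)"
    using Gamma_real_pos[OF add_pos_pos[OF b(2) d(1)]] by (simp add: Beta_def)
  moreover have "r powr b * r powr (- b) = 1"
    using True by (simp flip: powr_add)
  moreover have "(LINT s|lborel_Icc T. rl_kernel d t s * (s powr b * rl_kernel b s r)) =
      (t - r) powr (b + d - 1) * r powr b / (Gamma b * Gamma d) * I"
    unfolding I_def using True assms by (intro rl_kernel_compose) auto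
  ultimately show ?thesis by simp
next
  case False
  \<comment> \<open>Either r = 0, where \<open>0 powr (- b)\<close> is 0, or t \<le> r, where no s
    lies strictly between r and t. Keeping r powr (- b) under the integral treats both at
    once.\<close>
  have "rl_kernel d t s * (s powr b * rl_kernel b s r) * r powr (- b) = 0" for s
    using False assms by (auto simp: rl_kernel_def)
  then have "(LINT s|lborel_Icc T. rl_kernel d t s * (s powr b * rl_kernel b s r) * r powr (- b)) = 0"
    by (simp only: Bochner_Integration.integral_zero)
  then have "(LINT s|lborel_Icc T. rl_kernel d t s * (s powr b * rl_kernel b s r)) * r powr (- b) = 0"
    by (simp only: integral_mult_left_zero)
  moreover have "fbm_kernel H t r = 0" using False by (auto simp: fbm_kernel_def)
  ultimately show ?thesis by simp
qed

text \<open>On [0, T] the operator is, up to the constant, the single integral operator with the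
  composed kernel \<open>?k\<close> applied to \<open>?g\<close>. It inherits square integrability
  from the iterated operators through their equality almost everywhere.\<close>

lemma fbm_op_factorization:
  assumes b: "b = \<bar>H - 1/2\<bar>" "0 < b" and d: "0 < d" "b + d = H + 1/2"
    and f: "power_mult_op (- b) f \<in> L2_space T"
  shows "fbm_op H f \<in> L2_space T"
    and "AE t in lborel_Icc T. fbm_op H f t = fbm_const H *
      riemann_liouville d (power_mult_op b (riemann_liouville b (power_mult_op (- b) f))) t"
proof -
  interpret sigma_finite_measure "lborel_Icc T" by (rule sigma_finite_lborel_Icc)
  let ?M = "lborel_Icc T" and ?g = "power_mult_op (- b) f"
  let ?l = "\<lambda>s r. s powr b * rl_kernel b s r"
  let ?k = "\<lambda>t r. LINT s|?M. rl_kernel d t s * ?l s r"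
  let ?R = "riemann_liouville d (power_mult_op b (riemann_liouville b ?g))"
  obtain C where k: "schur_kernel ?M (rl_kernel d) C"
    using schur_kernel_rl_kernel[OF d(1)] by blast
  obtain D where D: "schur_kernel ?M (rl_kernel b) D"
    using schur_kernel_rl_kernel[OF b(2)] by blast
  have l: "schur_kernel ?M ?l (T powr b * D)"
    by (rule schur_kernel_mult_left[OF D]) (use b in \<open>auto intro: powr_mono2\<close>)
  have g: "?g \<in> square_integrable ?M" using f by (simp add: L2_space_eq)
  have [measurable]: "?g \<in> borel_measurable ?M" "case_prod (rl_kernel d) \<in> borel_measurable (?M \<Otimes>\<^sub>M ?M)"
      "case_prod ?l \<in> borel_measurable (?M \<Otimes>\<^sub>M ?M)"
    using g k l by (auto simp: square_integrable_def schur_kernel_def)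
  have fbm: "fbm_op H f t = fbm_const H * kernel_op ?M ?k ?g t" if t: "t \<in> {0..T}" for t
  proof -
    have "fbm_op H f t = (LBINT \<tau>. indicator {0..T} \<tau> * (fbm_kernel H t \<tau> * f \<tau>))"
      unfolding fbm_op_def set_lebesgue_integral_def using t
      by (intro Bochner_Integration.integral_cong) (auto simp: fbm_kernel_def indicator_def)
    also have "\<dots> = (LINT \<tau>|?M. fbm_kernel H t \<tau> * f \<tau>)"
      by (simp add: integral_lborel_Icc)
    also have "\<dots> = (LINT \<tau>|?M. fbm_const H * (?k t \<tau> * ?g \<tau>))"
    proof (intro Bochner_Integration.integral_cong refl)
      fix \<tau> assume "\<tau> \<in> space ?M"
      then have "\<tau> \<in> {0..T}" by simp
      from fbm_kernel_eq_compose[OF b d this t]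
      show "fbm_kernel H t \<tau> * f \<tau> = fbm_const H * (?k t \<tau> * ?g \<tau>)"
        by (simp add: power_mult_op_def)
    qed
    finally show ?thesis by (simp add: kernel_op_def)
  qed
  have R: "?R t = kernel_op ?M (rl_kernel d) (kernel_op ?M ?l ?g) t" if t: "t \<in> {0..T}" for t
    unfolding riemann_liouville_eq_kernel_op[OF t]
    by (intro kernel_op_cong)
       (simp add: power_mult_op_def riemann_liouville_eq_kernel_op[where T = T] kernel_op_def mult.assoc)
  have AE: "AE t in ?M. kernel_op ?M (rl_kernel d) (kernel_op ?M ?l ?g) t = kernel_op ?M ?k ?g t"
    by (rule kernel_op_compose_AE[OF k l g])
  then show "AE t in ?M. fbm_op H f t = fbm_const H * ?R t"
    using AE_space by eventually_elim (simp add: fbm R)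
  \<comment> \<open>Equality almost everywhere transfers square integrability only to a function
    known to be measurable.\<close>
  have "kernel_op ?M ?k ?g \<in> borel_measurable ?M"
    unfolding kernel_op_def by measurable
  with kernel_op_square_integrable[OF k kernel_op_square_integrable[OF l g]]
  have "kernel_op ?M ?k ?g \<in> square_integrable ?M"
    using AE by (rule square_integrable_cong_AE)
  then have "(\<lambda>t. fbm_const H * kernel_op ?M ?k ?g t) \<in> L2_space T"
    unfolding L2_space_eq by (rule square_integrable_scale)
  then show "fbm_op H f \<in> L2_space T"
    by (subst L2_space_cong[OF fbm])
qed

lemma L2_inner_cong_AE:
  assumes "f \<in> L2_space T" "g \<in> L2_space T" "h \<in> L2_space T" "AE t in lborel_Icc T. g t = h t"
  shows "L2_inner T f g = L2_inner T f h"
  unfolding L2_inner_eq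
  by (rule integral_cong_AE) (use assms in \<open>auto simp: L2_space_eq square_integrable_def\<close>)

text \<open>As \<open>\<star>\<close> associates to the left, each product appends one factor to a
  composition that already has an adjoint, and the unbounded operator enters last, on basis
  functions only. Entries ignore null sets, so the factorisation almost everywhere becomes an exact
  matrix identity.\<close>

lemma spectral_fbm_factorization:
  assumes q: "L2_orthonormal_basis T q" and b: "b = \<bar>H - 1/2\<bar>" "0 < b"
    and d: "0 < d" "b + d = H + 1/2" and dom: "\<And>j. power_mult_op (- b) (q j) \<in> L2_space T"
  shows "has_spectral_characteristic T q (fbm_op H)"
    and "\<forall>\<L> \<in> {riemann_liouville d, power_mult_op b, riemann_liouville b, power_mult_op (- b)}.
      has_spectral_characteristic T q \<L>"
    and "well_defined_product [spectral_P T q d, spectral_A T q b, spectral_P T q b, spectral_A T q (- b)]"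
    and "spectral_K T q H = fbm_const H \<odot>
      (spectral_P T q d \<star> spectral_A T q b \<star> spectral_P T q b \<star> spectral_A T q (- b))"
proof -
  have q_in: "q j \<in> L2_space T" for j
    using q by (auto simp: L2_orthonormal_basis_def)
  have adj: "has_adjoint T (riemann_liouville d)" "has_adjoint T (power_mult_op b)"
      "has_adjoint T (riemann_liouville b)"
    using b d by (auto intro: has_adjoint_riemann_liouville has_adjoint_power_mult_op)
  have maps: "riemann_liouville d f \<in> L2_space T" "power_mult_op b f \<in> L2_space T"
      "riemann_liouville b f \<in> L2_space T" if "f \<in> L2_space T" for f
    using that adj by (auto simp: has_adjoint_def)
  note fbm = fbm_op_factorization[OF b d dom]
  show "has_spectral_characteristic T q (fbm_op H)"
    using fbm(1) q_in by (simp add: has_spectral_characteristic_def)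
  show "\<forall>\<L> \<in> {riemann_liouville d, power_mult_op b, riemann_liouville b, power_mult_op (- b)}.
      has_spectral_characteristic T q \<L>"
    using q_in dom maps by (auto simp: has_spectral_characteristic_def)
  show "well_defined_product [spectral_P T q d, spectral_A T q b, spectral_P T q b, spectral_A T q (- b)]"
    using bracketing_invariant_spectral_characteristic[OF q,
        of "[riemann_liouville d, power_mult_op b, riemann_liouville b, power_mult_op (- b)]"] adj dom
    by (auto simp: well_defined_product_def)
  let ?R = "\<lambda>f. riemann_liouville d (power_mult_op b (riemann_liouville b (power_mult_op (- b) f)))"
  have R_in: "?R (q j) \<in> L2_space T" for j
    by (intro maps dom)
  have comp: "spectral_characteristic T q L \<star> spectral_characteristic T q R = spectral_characteristic T q (L \<circ> R)"
    if "has_adjoint T L" "\<And>j. R (q j) \<in> L2_space T" for L R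
    using that by (rule spectral_characteristic_comp(2)[OF q, of L R])
  have "spectral_P T q d \<star> spectral_A T q b = spectral_characteristic T q (riemann_liouville d \<circ> power_mult_op b)"
    by (rule comp) (intro adj maps q_in)+
  moreover have "spectral_characteristic T q (riemann_liouville d \<circ> power_mult_op b) \<star> spectral_P T q b =
      spectral_characteristic T q (riemann_liouville d \<circ> power_mult_op b \<circ> riemann_liouville b)"
    by (rule comp) (intro has_adjoint_comp adj maps q_in)+
  moreover have "spectral_characteristic T q (riemann_liouville d \<circ> power_mult_op b \<circ> riemann_liouville b) \<star>
      spectral_A T q (- b) = spectral_characteristic T q
        (riemann_liouville d \<circ> power_mult_op b \<circ> riemann_liouville b \<circ> power_mult_op (- b))"
    by (rule comp) (intro has_adjoint_comp adj dom)+
  moreover have "spectral_K T q H i j = fbm_const H * spectral_characteristic T q ?R i j" for i j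
  proof -
    have scaled: "(\<lambda>t. fbm_const H * ?R (q j) t) \<in> L2_space T"
      using R_in square_integrable_scale unfolding L2_space_eq by blast
    have "spectral_K T q H i j = L2_inner T (q i) (\<lambda>t. fbm_const H * ?R (q j) t)"
      unfolding spectral_characteristic_def by (rule L2_inner_cong_AE[OF q_in fbm(1) scaled fbm(2)])
    also have "\<dots> = fbm_const H * L2_inner T (q i) (?R (q j))"
      by (simp add: L2_inner_eq mult.left_commute)
    finally show ?thesis by (simp add: spectral_characteristic_def)
  qed
  ultimately show "spectral_K T q H = fbm_const H \<odot>
      (spectral_P T q d \<star> spectral_A T q b \<star> spectral_P T q b \<star> spectral_A T q (- b))"
    by (auto simp: inf_scale_def o_def intro!: ext)
qed

theorem mainTheorem2:
  fixes T H :: real and q :: "nat \<Rightarrow> real \<Rightarrow> real"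
  assumes "0 < T"
    and "0 < H" and "H < 1" and "H \<noteq> 1/2"
    and "L2_orthonormal_basis T q"
    and "\<And>j. power_mult_op (- \<bar>H - 1/2\<bar>) (q j) \<in> L2_space T"
  shows "has_spectral_characteristic T q (fbm_op H) \<and>
    (H < 1/2 \<longrightarrow>
       (\<forall>\<L> \<in> {riemann_liouville (2 * H), power_mult_op (1/2 - H),
               riemann_liouville (1/2 - H), power_mult_op (H - 1/2)}.
          has_spectral_characteristic T q \<L>) \<and>
       well_defined_product [spectral_P T q (2 * H), spectral_A T q (1/2 - H),
                             spectral_P T q (1/2 - H), spectral_A T q (H - 1/2)] \<and>
       spectral_K T q H =
         fbm_const H \<odot> (spectral_P T q (2 * H) \<star> spectral_A T q (1/2 - H) \<star>
                         spectral_P T q (1/2 - H) \<star> spectral_A T q (H - 1/2))) \<and>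
    (H > 1/2 \<longrightarrow>
       (\<forall>\<L> \<in> {riemann_liouville 1, power_mult_op (H - 1/2),
               riemann_liouville (H - 1/2), power_mult_op (1/2 - H)}.
          has_spectral_characteristic T q \<L>) \<and>
       well_defined_product [spectral_P T q 1, spectral_A T q (H - 1/2),
                             spectral_P T q (H - 1/2), spectral_A T q (1/2 - H)] \<and>
       spectral_K T q H =
         fbm_const H \<odot> (spectral_P T q 1 \<star> spectral_A T q (H - 1/2) \<star>
                         spectral_P T q (H - 1/2) \<star> spectral_A T q (1/2 - H)))"
proof (cases "H < 1/2")
  case True
  have b: "1/2 - H = \<bar>H - 1/2\<bar>" "- (1/2 - H) = H - 1/2" using True by auto
  have "power_mult_op (- (1/2 - H)) (q j) \<in> L2_space T" for j
    using assms(6) unfolding b(1) .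
  from spectral_fbm_factorization[OF assms(5) b(1) _ _ _ this, of "2 * H"] show ?thesis
    using True assms(2) unfolding b(2) by simp
next
  case False
  then have "1/2 < H" using assms(4) by simp
  have b: "H - 1/2 = \<bar>H - 1/2\<bar>" "- (H - 1/2) = 1/2 - H" using \<open>1/2 < H\<close> by auto
  have "power_mult_op (- (H - 1/2)) (q j) \<in> L2_space T" for j
    using assms(6) b(1) by simp
  from spectral_fbm_factorization[OF assms(5) b(1) _ _ _ this, of 1] show ?thesis
    using \<open>1/2 < H\<close> unfolding b(2) by simp
qed

end
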